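(* The type fan $\mathcal{F}_n$ of alcoved polytopes is two-determined: if $\rho_1,\dots,\rho_s$ are rays of $\mathcal{F}_n$ such that every pair $\rho_i,\rho_j$ belongs to some cone of $\mathcal{F}_n$, then there exists a cone of $\mathcal{F}_n$ containing all of $\rho_1,\dots,\rho_s$.
   Context: $\mathcal{H}_n=\{x\in\mathbb{R}^n:\sum x_i=0\}$. An alcoved polytope is one of the form $P=\{x\in\mathcal{H}_n:x_i-x_j\le a_{i,j}\ \forall i\ne j\}$; the parameters $(a_{i,j})\in\mathbb{R}^{(n-1)n}$ define $P$ minimally if $a_{i,j}=\max_{x\in P}(x_i-x_j)$ for all $i\ne j$. The set of minimally defining parameter vectors is a cone in $\mathbb{R}^{(n-1)n}$, partitioned into relatively open cones each consisting of the parameter vectors whose polytopes have a common normal fan; these cones form the type fan $\mathcal{F}_n$. *)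

theory Defs
  imports "HOL-Analysis.Analysis"
begin

definition sum_zero_space :: "(real ^ 'n) set" where
  "sum_zero_space = {x. (\<Sum>i\<in>UNIV. x $ i) = 0}"

text \<open>The coordinates are the \<open>a $ i $ j\<close> with \<open>i \<noteq> j\<close>; fixing the unused diagonal
  entries to 0 gives a copy of the space of dimension \<open>n(n - 1)\<close> inside the matrices.\<close>

definition param_space :: "(real ^ 'n ^ 'n) set" where
  "param_space = {a. \<forall>i. a $ i $ i = 0}"

definition alcoved :: "real ^ 'n ^ 'n \<Rightarrow> (real ^ 'n) set" where
  "alcoved a = {x \<in> sum_zero_space. \<forall>i j. i \<noteq> j \<longrightarrow> x $ i - x $ j \<le> a $ i $ j}"

definition defines_minimally :: "real ^ 'n ^ 'n \<Rightarrow> bool" where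
  "defines_minimally a \<longleftrightarrow>
     (\<forall>i j. i \<noteq> j \<longrightarrow>
        (\<exists>x\<in>alcoved a. a $ i $ j = x $ i - x $ j \<and>
           (\<forall>y\<in>alcoved a. y $ i - y $ j \<le> x $ i - x $ j)))"

definition minimal_params :: "(real ^ 'n ^ 'n) set" where
  "minimal_params = {a \<in> param_space. defines_minimally a}"

definition normal_cone :: "'a::euclidean_space set \<Rightarrow> 'a set \<Rightarrow> 'a set" where
  "normal_cone P F = {c. \<forall>x\<in>F. \<forall>y\<in>P. c \<bullet> y \<le> c \<bullet> x}"

definition normal_fan :: "'a::euclidean_space set \<Rightarrow> 'a set set" where
  "normal_fan P = {normal_cone P F | F. F face_of P \<and> F \<noteq> {}}"

definition open_type_cone :: "real ^ 'n ^ 'n \<Rightarrow> (real ^ 'n ^ 'n) set" where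
  "open_type_cone a =
     {b \<in> minimal_params. normal_fan (alcoved b) = normal_fan (alcoved a)}"

text \<open>As a fan, the type fan consists of the closures of the relatively open cones
  that partition the minimally defining parameters.\<close>

definition type_fan :: "(real ^ 'n ^ 'n) set set" where
  "type_fan = {closure (open_type_cone a) | a. a \<in> minimal_params}"

text \<open>The type fan is not pointed: translating a polytope by \<open>t\<close> adds \<open>t $ i - t $ j\<close> to
  \<open>a $ i $ j\<close>, so every cone contains the image of these translations.  Rays are therefore
  the cones that are one-dimensional modulo the lineality space of the fan.\<close>

definition fan_lineality :: "'a::euclidean_space set set \<Rightarrow> 'a set" where
  "fan_lineality \<F> = {x. \<forall>C\<in>\<F>. x \<in> C \<and> - x \<in> C}"

definition fan_rays :: "'a::euclidean_space set set \<Rightarrow> 'a set set" where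
  "fan_rays \<F> = {C \<in> \<F>. dim C = dim (fan_lineality \<F>) + 1}"

end

theory Submission
  imports Defs
begin

text \<open>
  By linear programming duality, \<open>max {w \<bullet> x | x \<in> alcoved a}\<close> is the least cost \<open>\<lambda> \<bullet> a\<close> of a
  nonnegative transport plan \<open>\<lambda>\<close> with boundary \<open>w\<close>, and the normal fan of \<open>alcoved a\<close> and the set
  of optimal plans for \<open>a\<close> determine each other.  Optimality of a fixed plan is a closed condition
  on \<open>a\<close>, so the members of one cone of the type fan share an optimal plan for every \<open>w\<close>.
  Conversely, if finitely many parameters share an optimal plan for every \<open>w\<close>, then they lie in
  the cone of their sum.

  It remains to see that parameters which pairwise share an optimal plan for every \<open>w\<close> have one in
  common.  Induct on the size of the support of \<open>w\<close> plus the sizes of the sets of edges used by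
  the optimal plans for \<open>w\<close>, and take \<open>w $ p > 0 > w $ q\<close>.  If \<open>p\<close> and \<open>q\<close> lie in different
  components of the edges used for some \<open>a\<close>, then the plan shared by \<open>a\<close> and \<open>b\<close> splits along this
  component for every \<open>b\<close>, so \<open>w\<close> splits into two smaller vectors.  Otherwise \<open>w\<close> can be moved
  along the root \<open>e\<^sub>p - e\<^sub>q\<close> in both directions without leaving the cones spanned by the used edges,
  until some edge or some coordinate of \<open>w\<close> drops out.
\<close>

section \<open>Transport plans\<close>

text \<open>Net outflow of the flow that sends \<open>l $ i $ j\<close> from \<open>i\<close> to
  \<open>j\<close>; loops \<open>l $ i $ i\<close> cancel.\<close>

definition boundary :: "real ^ 'n ^ 'n \<Rightarrow> real ^ 'n" where
  "boundary l = (\<chi> i. (\<Sum>j\<in>UNIV. l $ i $ j) - (\<Sum>j\<in>UNIV. l $ j $ i))"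

definition root_vec :: "'n \<Rightarrow> 'n \<Rightarrow> real ^ 'n" where
  "root_vec p q = axis p 1 - axis q 1"

definition unit_plan :: "'n \<Rightarrow> 'n \<Rightarrow> real ^ 'n ^ 'n" where
  "unit_plan p q = axis p (axis q 1)"

definition plans_on :: "('n \<times> 'n) set \<Rightarrow> (real ^ 'n ^ 'n) set" where
  "plans_on T = {l. (\<forall>i j. 0 \<le> l $ i $ j) \<and> (\<forall>i j. l $ i $ j \<noteq> 0 \<longrightarrow> (i, j) \<in> T)}"

definition flow_cone :: "('n \<times> 'n) set \<Rightarrow> (real ^ 'n) set" where
  "flow_cone T = boundary ` plans_on T"

text \<open>The linear program dual to maximizing \<open>boundary l\<close> over
  \<open>alcoved a\<close>: the competing plans are those with the boundary of
  \<open>l\<close>.\<close>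

definition opt :: "real ^ 'n ^ 'n \<Rightarrow> real ^ 'n ^ 'n \<Rightarrow> bool" where
  "opt a l \<longleftrightarrow> l \<in> plans_on UNIV \<and>
     (\<forall>m\<in>plans_on UNIV. boundary m = boundary l \<longrightarrow> l \<bullet> a \<le> m \<bullet> a)"

text \<open>The union of the supports of all optimal plans for \<open>w\<close>. For minimal
  \<open>a\<close> it is also the tight set of a suitable point of the polytope
  (\<open>opt_support_eq_tight\<close>).\<close>

definition opt_support :: "real ^ 'n ^ 'n \<Rightarrow> real ^ 'n \<Rightarrow> ('n \<times> 'n) set" where
  "opt_support a w = {(i, j). \<exists>l. opt a l \<and> boundary l = w \<and> l $ i $ j > 0}"

section \<open>Boundaries as combinations of roots\<close>

lemma linear_boundary: "linear boundary"
  by (rule linearI) (simp_all add: boundary_def vec_eq_iff sum.distrib sum_distrib_left algebra_simps)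

lemmas boundary_add = linear_add[OF linear_boundary]
  and boundary_diff = linear_diff[OF linear_boundary]
  and boundary_scaleR = linear_cmul[OF linear_boundary]

lemma root_vec_nth: "root_vec p q $ i = (if i = p then 1 else 0) - (if i = q then 1 else 0)"
  by (simp add: root_vec_def axis_def)

lemma unit_plan_nth: "unit_plan p q $ i $ j = (if i = p \<and> j = q then 1 else 0)"
  by (simp add: unit_plan_def axis_def)

lemma boundary_unit_plan: "boundary (unit_plan p q) = root_vec p q"
proof -
  have 1: "(\<Sum>j\<in>UNIV. unit_plan p q $ i $ j) = (if i = p then 1 else 0)" for i
    by (cases "i = p") (simp_all add: unit_plan_nth)
  have 2: "(\<Sum>j\<in>UNIV. unit_plan p q $ j $ i) = (if i = q then 1 else 0)" for i
    by (cases "i = q") (simp_all add: unit_plan_nth)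
  show ?thesis
    by (simp add: boundary_def vec_eq_iff root_vec_nth 1 2)
qed

lemma inner_root_vec: "root_vec p q \<bullet> x = x $ p - x $ q"
  by (simp add: root_vec_def inner_diff_left inner_axis')

lemma plan_eq_sum: "l = (\<Sum>i\<in>UNIV. \<Sum>j\<in>UNIV. (l $ i $ j) *\<^sub>R unit_plan i j)"
proof -
  have "(\<Sum>j\<in>UNIV. l $ i $ j * unit_plan i j $ p $ q) = (if i = p then l $ p $ q else 0)" for i p q
    by (cases "i = p") (simp_all add: unit_plan_nth if_distrib[of "\<lambda>x. _ * x"] cong: if_cong)
  then show ?thesis
    by (simp add: vec_eq_iff)
qed

lemma boundary_eq_sum: "boundary l = (\<Sum>i\<in>UNIV. \<Sum>j\<in>UNIV. (l $ i $ j) *\<^sub>R root_vec i j)"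
  by (subst plan_eq_sum)
    (simp add: linear_sum[OF linear_boundary] boundary_scaleR boundary_unit_plan)

lemma inner_boundary:
  "boundary l \<bullet> x = (\<Sum>i\<in>UNIV. \<Sum>j\<in>UNIV. l $ i $ j * (x $ i - x $ j))"
  by (simp add: boundary_eq_sum inner_sum_left inner_root_vec)

lemma inner_plan: "l \<bullet> a = (\<Sum>i\<in>UNIV. \<Sum>j\<in>UNIV. l $ i $ j * a $ i $ j)"
  for l :: "real ^ 'n ^ 'n"
  by (simp add: inner_vec_def)

lemma boundary_sum_zero: "boundary l \<in> sum_zero_space"
  by (simp add: sum_zero_space_def boundary_def sum_subtractf) (rule sum.swap)

section \<open>Cones of plans and of their boundaries\<close>

lemma plans_on_nonneg: "l \<in> plans_on T \<Longrightarrow> 0 \<le> l $ i $ j"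
  by (simp add: plans_on_def)

lemma plans_on_mono: "l \<in> plans_on T \<Longrightarrow> T \<subseteq> T' \<Longrightarrow> l \<in> plans_on T'"
  by (auto simp: plans_on_def)

lemma plans_on_support:
  "l \<in> plans_on UNIV \<Longrightarrow> (\<And>i j. l $ i $ j > 0 \<Longrightarrow> (i, j) \<in> T) \<Longrightarrow> l \<in> plans_on T"
  by (simp add: plans_on_def order_less_le)

lemma plans_on_add: "l \<in> plans_on T \<Longrightarrow> m \<in> plans_on T \<Longrightarrow> l + m \<in> plans_on T"
  unfolding plans_on_def by (simp, metis add.right_neutral)

lemma plans_on_scaleR: "l \<in> plans_on T \<Longrightarrow> 0 \<le> c \<Longrightarrow> c *\<^sub>R l \<in> plans_on T"
  by (auto simp: plans_on_def)

lemma plans_on_zero: "0 \<in> plans_on T"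
  by (simp add: plans_on_def)

lemma plans_on_unit: "(p, q) \<in> T \<Longrightarrow> unit_plan p q \<in> plans_on T"
  by (auto simp: plans_on_def unit_plan_nth split: if_splits)

lemma convex_cone_flow_cone: "convex_cone (flow_cone T)"
  unfolding convex_cone_iff flow_cone_def
proof (intro conjI ballI allI impI)
  show "0 \<in> boundary ` plans_on T"
    using plans_on_zero linear_0[OF linear_boundary] by (metis image_eqI)
next
  fix x y :: "real ^ 'a" assume "x \<in> boundary ` plans_on T" "y \<in> boundary ` plans_on T"
  then show "x + y \<in> boundary ` plans_on T"
    by (auto simp flip: boundary_add intro!: imageI plans_on_add)
next
  fix x :: "real ^ 'a" and c :: real assume "x \<in> boundary ` plans_on T" "c \<ge> 0"
  then show "c *\<^sub>R x \<in> boundary ` plans_on T"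
    by (auto simp flip: boundary_scaleR intro!: imageI plans_on_scaleR)
qed

text \<open>The image form hands out plans as witnesses; the generated form gives closedness and
  access to separation arguments.\<close>

lemma flow_cone_eq_hull: "flow_cone T = convex_cone hull ((\<lambda>(p, q). root_vec p q) ` T)"
proof
  have "root_vec p q \<in> flow_cone T" if "(p, q) \<in> T" for p q
    using plans_on_unit[OF that] boundary_unit_plan unfolding flow_cone_def by (metis image_eqI)
  then show "convex_cone hull ((\<lambda>(p, q). root_vec p q) ` T) \<subseteq> flow_cone T"
    by (intro hull_minimal convex_cone_flow_cone) auto
next
  let ?H = "convex_cone hull ((\<lambda>(p, q). root_vec p q) ` T)"
  have sum: "(\<Sum>i\<in>I. f i) \<in> ?H" if "finite I" "\<And>i. i \<in> I \<Longrightarrow> f i \<in> ?H" for I :: "'a set" and f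
    using that by (induction I rule: finite_induct)
      (auto intro: convex_cone_hull_add simp: convex_cone_hull_contains_0)
  show "flow_cone T \<subseteq> ?H"
  proof
    fix w assume "w \<in> flow_cone T"
    then obtain l where l: "l \<in> plans_on T" "w = boundary l"
      by (auto simp: flow_cone_def)
    have "(l $ i $ j) *\<^sub>R root_vec i j \<in> ?H" for i j
    proof (cases "l $ i $ j = 0")
      case False
      then have "(i, j) \<in> T"
        using l(1) by (auto simp: plans_on_def)
      then have "root_vec i j \<in> ?H"
        by (intro hull_inc) force
      then show ?thesis
        by (intro convex_cone_hull_mul plans_on_nonneg[OF l(1)])
    qed (simp add: convex_cone_hull_contains_0)
    then show "w \<in> ?H"
      unfolding l(2) boundary_eq_sum by (intro sum) auto
  qed
qed

lemma closed_flow_cone: "closed (flow_cone T)"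
  unfolding flow_cone_eq_hull by (rule closed_convex_cone_hull) simp

section \<open>Small perturbations of plans\<close>

lemma eventually_small_multiple: "0 < (l::real) \<Longrightarrow> \<forall>\<^sub>F e in at_right 0. e * k < l"
proof -
  assume l: "0 < l"
  have "((\<lambda>e. e * k) \<longlongrightarrow> 0 * k) (at_right 0)"
    by (intro tendsto_intros)
  then show ?thesis
    using order_tendstoD(2)[of "\<lambda>e. e * k" "0 * k" _ l] l by simp
qed

text \<open>Where \<open>k\<close> is not positive, every \<open>e > 0\<close> works because
  \<open>l\<close> is nonnegative; the finitely many other entries have room. The filter form spares
  taking minima over entries.\<close>

lemma eventually_multiple_below_plan:
  fixes l k :: "real ^ 'n ^ 'n"
  assumes "l \<in> plans_on UNIV" "\<And>i j. k $ i $ j > 0 \<Longrightarrow> l $ i $ j > 0"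
  shows "\<forall>\<^sub>F e in at_right (0::real). \<forall>i j. e * k $ i $ j \<le> l $ i $ j"
proof -
  have "\<forall>\<^sub>F e in at_right 0. e * k $ i $ j \<le> l $ i $ j" for i j
  proof (cases "k $ i $ j > 0")
    case True
    then show ?thesis
      by (intro eventually_mono[OF eventually_small_multiple[OF assms(2)[OF True], of "k $ i $ j"]]) simp
  next
    case False
    have "0 \<le> l $ i $ j" using assms(1) by (rule plans_on_nonneg)
    moreover have "e * k $ i $ j \<le> 0" if "0 < e" for e :: real
      using False that by (simp add: mult_nonneg_nonpos)
    ultimately show ?thesis
      by (intro eventually_mono[OF eventually_at_right_less]) (meson order_trans)
  qed
  then show ?thesis
    by (intro eventually_all_finite)
qed

lemma eventually_at_right_obtain:
  assumes "\<forall>\<^sub>F e in at_right (0::real). P e"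
  obtains e where "0 < e" "P e"
  using eventually_happens'[OF trivial_limit_at_right_real eventually_conj[OF eventually_at_right_less assms]]
  by blast

section \<open>Optimal plans and their supports\<close>

lemma opt_plan: "opt a l \<Longrightarrow> l \<in> plans_on UNIV"
  by (simp add: opt_def)

lemma opt_le: "opt a l \<Longrightarrow> m \<in> plans_on UNIV \<Longrightarrow> boundary m = boundary l \<Longrightarrow> l \<bullet> a \<le> m \<bullet> a"
  by (simp add: opt_def)

lemma opt_cong_cost:
  assumes "opt a l" "m \<in> plans_on UNIV" "boundary m = boundary l" "m \<bullet> a \<le> l \<bullet> a"
  shows "opt a m"
  unfolding opt_def
proof (intro conjI ballI impI assms(2))
  fix n assume "n \<in> plans_on UNIV" "boundary n = boundary m"
  then show "m \<bullet> a \<le> n \<bullet> a"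
    using opt_le[OF assms(1), of n] assms(3,4) by simp
qed

text \<open>Replaces a small part \<open>e *\<^sub>R m\<close> of \<open>l\<close> by
  \<open>e *\<^sub>R n\<close>. By \<open>sub\<close>, \<open>l\<close> is positive wherever
  \<open>m\<close> is, so nothing turns negative for small \<open>e\<close>.\<close>

lemma opt_exchange:
  assumes l: "opt a l" and m: "m \<in> plans_on UNIV" and sub: "\<And>i j. m $ i $ j > 0 \<Longrightarrow> l $ i $ j > 0"
    and n: "n \<in> plans_on UNIV" "boundary n = boundary m"
  obtains e where "0 < e" "l - e *\<^sub>R m + e *\<^sub>R n \<in> plans_on UNIV"
    "boundary (l - e *\<^sub>R m + e *\<^sub>R n) = boundary l"
proof -
  obtain e where e: "0 < e" "\<And>i j. e * m $ i $ j \<le> l $ i $ j"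
    using eventually_at_right_obtain[OF eventually_multiple_below_plan[OF opt_plan[OF l] sub]] by metis
  show ?thesis
  proof
    show "0 < e" by fact
    show "l - e *\<^sub>R m + e *\<^sub>R n \<in> plans_on UNIV"
      using e plans_on_nonneg[OF n(1)] by (auto simp: plans_on_def intro!: add_nonneg_nonneg)
    show "boundary (l - e *\<^sub>R m + e *\<^sub>R n) = boundary l"
      by (simp add: boundary_add boundary_diff boundary_scaleR n(2))
  qed
qed

text \<open>If a plan supported inside an optimal plan could be improved, then so could the optimal
  plan, by exchanging a small multiple.\<close>

lemma opt_subsupport:
  assumes l: "opt a l" and m: "m \<in> plans_on UNIV" and sub: "\<And>i j. m $ i $ j > 0 \<Longrightarrow> l $ i $ j > 0"
  shows "opt a m"
  unfolding opt_def
proof (intro conjI ballI impI m)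
  fix n assume n: "n \<in> plans_on UNIV" "boundary n = boundary m"
  obtain e where e: "0 < e" "l - e *\<^sub>R m + e *\<^sub>R n \<in> plans_on UNIV"
    "boundary (l - e *\<^sub>R m + e *\<^sub>R n) = boundary l"
    using opt_exchange[OF l m sub n] by blast
  have "l \<bullet> a \<le> (l - e *\<^sub>R m + e *\<^sub>R n) \<bullet> a"
    by (rule opt_le[OF l e(2,3)])
  then have "0 \<le> e * (n \<bullet> a - m \<bullet> a)"
    by (simp add: inner_add_left inner_diff_left algebra_simps)
  then show "m \<bullet> a \<le> n \<bullet> a"
    using e(1) by (simp add: zero_le_mult_iff)
qed

lemma opt_midpoint:
  assumes "opt a l" "opt a m" "boundary l = boundary m"
  shows "opt a ((1/2) *\<^sub>R (l + m))"
proof (rule opt_cong_cost[OF assms(1)])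
  show "(1/2) *\<^sub>R (l + m) \<in> plans_on UNIV"
    using assms by (intro plans_on_scaleR plans_on_add opt_plan) auto
  show "boundary ((1/2) *\<^sub>R (l + m)) = boundary l"
    by (simp add: boundary_add boundary_scaleR assms(3) scaleR_2[symmetric])
  have "l \<bullet> a = m \<bullet> a"
    using assms by (intro antisym opt_le opt_plan) auto
  then show "(1/2) *\<^sub>R (l + m) \<bullet> a \<le> l \<bullet> a"
    by (simp add: inner_add_left)
qed

text \<open>An optimal plan with the most edges uses every edge in question: its midpoint with an
  optimal plan using a missing edge would have more.\<close>

lemma full_support_plan:
  assumes "\<exists>l. opt a l \<and> boundary l = w"
  obtains l where "opt a l" "boundary l = w" "\<And>i j. l $ i $ j > 0 \<longleftrightarrow> (i, j) \<in> opt_support a w"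
proof -
  let ?supp = "\<lambda>l::real ^ 'a ^ 'a. {(i, j). l $ i $ j > 0}"
  obtain l0 where l0: "opt a l0" "boundary l0 = w"
    using assms by blast
  have "\<exists>l. (opt a l \<and> boundary l = w) \<and> (\<forall>m. opt a m \<and> boundary m = w \<longrightarrow> card (?supp m) \<le> card (?supp l))"
  proof (rule ex_has_greatest_nat[where b = "Suc (card (UNIV :: ('a \<times> 'a) set))"])
    show "opt a l0 \<and> boundary l0 = w" using l0 by simp
    show "\<forall>m. opt a m \<and> boundary m = w \<longrightarrow> card (?supp m) < Suc (card (UNIV :: ('a \<times> 'a) set))"
      by (intro allI impI le_imp_less_Suc card_mono) auto
  qed
  then obtain l where l: "opt a l" "boundary l = w"
    and max: "\<And>m. opt a m \<Longrightarrow> boundary m = w \<Longrightarrow> card (?supp m) \<le> card (?supp l)"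
    by blast
  have "l $ i $ j > 0" if m: "opt a m" "boundary m = w" "m $ i $ j > 0" for m i j
  proof (rule ccontr)
    assume c: "\<not> l $ i $ j > 0"
    let ?h = "(1/2) *\<^sub>R (l + m)"
    have h: "opt a ?h" "boundary ?h = w"
      using opt_midpoint[OF l(1) m(1)] l(2) m(2)
      by (simp_all add: boundary_add boundary_scaleR scaleR_2[symmetric])
    have "?supp l \<subseteq> ?supp ?h"
      using plans_on_nonneg[OF opt_plan[OF m(1)]] by (auto simp: add_pos_nonneg)
    moreover have "(i, j) \<in> ?supp ?h"
      using m(3) plans_on_nonneg[OF opt_plan[OF l(1)], of i j] by (simp add: add_nonneg_pos)
    ultimately have "?supp l \<subset> ?supp ?h"
      using c by auto
    then have "card (?supp l) < card (?supp ?h)"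
      by (intro psubset_card_mono) auto
    then show False using max[OF h] by simp
  qed
  then show ?thesis
    using that[OF l] l unfolding opt_support_def by blast
qed

lemma opt_plans_on_support:
  assumes "opt a l" "boundary l = w"
  shows "l \<in> plans_on (opt_support a w)"
  using assms by (intro plans_on_support[OF opt_plan[OF assms(1)]]) (auto simp: opt_support_def)

text \<open>Compare with a plan of full support. The boundary of \<open>m\<close> is arbitrary here:
  a plan on these edges is optimal for its own boundary.\<close>

lemma opt_on_support:
  assumes "\<exists>l. opt a l \<and> boundary l = w" "m \<in> plans_on (opt_support a w)"
  shows "opt a m"
proof -
  obtain l where l: "opt a l" "boundary l = w" "\<And>i j. l $ i $ j > 0 \<longleftrightarrow> (i, j) \<in> opt_support a w"
    by (rule full_support_plan[OF assms(1)]) (rule that)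
  show ?thesis
    using l(3) assms(2) by (intro opt_subsupport[OF l(1)]) (auto simp: plans_on_def)
qed

text \<open>Exchange, inside a full-support plan for \<open>w\<close>, a bit of a plan
  \<open>m\<close> for \<open>v\<close> against an optimal plan \<open>n\<close> for
  \<open>v\<close>. The cost does not rise, so the result is optimal for \<open>w\<close> and shows
  the edges of \<open>n\<close>. This makes the measure of the later induction decrease.\<close>

lemma opt_support_mono:
  assumes ex: "\<exists>l. opt a l \<and> boundary l = w" and v: "v \<in> flow_cone (opt_support a w)"
  shows "opt_support a v \<subseteq> opt_support a w"
proof
  fix z assume "z \<in> opt_support a v"
  then obtain i j n where n: "z = (i, j)" "opt a n" "boundary n = v" "n $ i $ j > 0"
    by (auto simp: opt_support_def)
  obtain m where m: "m \<in> plans_on (opt_support a w)" "boundary m = v"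
    using v by (auto simp: flow_cone_def)
  have mU: "m \<in> plans_on UNIV" using m(1) by (rule plans_on_mono) simp
  obtain l where l: "opt a l" "boundary l = w" "\<And>i j. l $ i $ j > 0 \<longleftrightarrow> (i, j) \<in> opt_support a w"
    by (rule full_support_plan[OF ex]) (rule that)
  have sub: "m $ i $ j > 0 \<Longrightarrow> l $ i $ j > 0" for i j
    using l(3) m(1) by (auto simp: plans_on_def)
  obtain e where e: "0 < e" "l - e *\<^sub>R m + e *\<^sub>R n \<in> plans_on UNIV"
    "boundary (l - e *\<^sub>R m + e *\<^sub>R n) = boundary l"
    using opt_exchange[OF l(1) mU sub opt_plan[OF n(2)]] n(3) m(2) by metis
  show "z \<in> opt_support a w"
  proof (cases "m $ i $ j > 0")
    case True
    then show ?thesis using l(3) sub n(1) by simp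
  next
    \<comment> \<open>As \<open>m\<close> avoids this edge, removing \<open>m\<close> leaves the
      entry alone and adding \<open>n\<close> makes it positive.\<close>
    case False
    then have m0: "m $ i $ j = 0" using plans_on_nonneg[OF m(1), of i j] by simp
    have "n \<bullet> a \<le> m \<bullet> a"
      using opt_le[OF n(2) mU] m(2) n(3) by simp
    then have "opt a (l - e *\<^sub>R m + e *\<^sub>R n)"
      using e(1) by (intro opt_cong_cost[OF l(1) e(2,3)]) (simp add: inner_add_left inner_diff_left)
    moreover have "(l - e *\<^sub>R m + e *\<^sub>R n) $ i $ j > 0"
      using e(1) n(4) m0 plans_on_nonneg[OF opt_plan[OF l(1)], of i j] by (simp add: add_nonneg_pos)
    ultimately show ?thesis
      using l(2) e(3) n(1) unfolding opt_support_def by blast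
  qed
qed

section \<open>Plans shared by several cost matrices\<close>

abbreviation linked :: "('n \<times> 'n) set \<Rightarrow> ('n \<times> 'n) set" where
  "linked T \<equiv> (T \<union> T\<inverse>)\<^sup>*"

definition restrict_vec :: "'n set \<Rightarrow> real ^ 'n \<Rightarrow> real ^ 'n" where
  "restrict_vec B w = (\<chi> i. if i \<in> B then w $ i else 0)"

text \<open>Keep the edges of \<open>l\<close> that start in \<open>B\<close>. No used edge crosses
  between \<open>B\<close> and its complement, so these are also the edges that end in
  \<open>B\<close>.\<close>

lemma restrict_in_flow_cone:
  assumes l: "l \<in> plans_on T" and T: "\<And>i j. l $ i $ j \<noteq> 0 \<Longrightarrow> i \<in> B \<longleftrightarrow> j \<in> B"
  shows "restrict_vec B (boundary l) \<in> flow_cone T"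
proof -
  define k where "k = (\<chi> i j. if i \<in> B then l $ i $ j else 0)"
  have "k \<in> plans_on T"
    using l by (auto simp: plans_on_def k_def)
  moreover have "boundary k = restrict_vec B (boundary l)"
  proof -
    have row: "k $ i $ j = (if i \<in> B then l $ i $ j else 0)" for i j
      by (simp add: k_def)
    have col: "k $ j $ i = (if i \<in> B then l $ j $ i else 0)" for i j
      using T[of j i] by (auto simp: k_def)
    have "(\<Sum>j\<in>UNIV. k $ i $ j) = (if i \<in> B then \<Sum>j\<in>UNIV. l $ i $ j else 0)" for i
      by (simp add: row)
    moreover have "(\<Sum>j\<in>UNIV. k $ j $ i) = (if i \<in> B then \<Sum>j\<in>UNIV. l $ j $ i else 0)" for i
      by (simp add: col)
    ultimately show ?thesis
      by (simp add: vec_eq_iff boundary_def restrict_vec_def)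
  qed
  ultimately show ?thesis
    by (metis flow_cone_def image_eqI)
qed

lemma restrict_vec_add_Compl: "restrict_vec B w + restrict_vec (- B) w = w"
  by (simp add: restrict_vec_def vec_eq_iff)

section \<open>Moving along a root inside a flow cone\<close>

lemma root_vec_swap: "root_vec q p = - root_vec p q"
  by (simp add: root_vec_def)

lemma linked_sym: "(p, q) \<in> linked T \<Longrightarrow> (q, p) \<in> linked T"
  by (meson sym_Un_converse sym_rtrancl symD)

text \<open>Telescope along an undirected path: an edge traversed backwards is subtracted, so
  \<open>k\<close> is signed and need not be a plan.\<close>

lemma linked_imp_root_vec_boundary:
  assumes "(p, q) \<in> linked T"
  shows "\<exists>k. boundary k = root_vec p q \<and> (\<forall>i j. k $ i $ j \<noteq> 0 \<longrightarrow> (i, j) \<in> T)"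
  using assms
proof (induction rule: rtrancl_induct)
  case base
  have "boundary 0 = root_vec p p"
    by (simp add: linear_0[OF linear_boundary] root_vec_def)
  then show ?case by (intro exI[of _ 0]) simp
next
  case (step y z)
  then obtain k where k: "boundary k = root_vec p y" "\<And>i j. k $ i $ j \<noteq> 0 \<Longrightarrow> (i, j) \<in> T"
    by blast
  from step.hyps(2) show ?case
  proof
    assume "(y, z) \<in> T"
    moreover have "boundary (k + unit_plan y z) = root_vec p z"
      by (simp add: boundary_add boundary_unit_plan k(1)) (simp add: root_vec_def)
    ultimately show ?thesis
      using k(2) by (intro exI[of _ "k + unit_plan y z"]) (auto simp: unit_plan_nth split: if_splits)
  next
    assume "(y, z) \<in> T\<inverse>"
    moreover have "boundary (k - unit_plan z y) = root_vec p z"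
      by (simp add: boundary_diff boundary_unit_plan k(1)) (simp add: root_vec_def)
    ultimately show ?thesis
      using k(2) by (intro exI[of _ "k - unit_plan z y"]) (auto simp: unit_plan_nth split: if_splits)
  qed
qed

text \<open>A full-support plan is positive on all admissible edges, so it absorbs a small multiple
  of the signed \<open>k\<close> from the path.\<close>

lemma eventually_move_in_flow_cone:
  assumes ex: "\<exists>l. opt a l \<and> boundary l = w" and pq: "(p, q) \<in> linked (opt_support a w)"
  shows "\<forall>\<^sub>F e in at_right 0. w + e *\<^sub>R root_vec p q \<in> flow_cone (opt_support a w)"
proof -
  obtain l where l: "opt a l" "boundary l = w" "\<And>i j. l $ i $ j > 0 \<longleftrightarrow> (i, j) \<in> opt_support a w"
    by (rule full_support_plan[OF ex]) (rule that)
  obtain k where k: "boundary k = root_vec p q" "\<And>i j. k $ i $ j \<noteq> 0 \<Longrightarrow> (i, j) \<in> opt_support a w"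
    using linked_imp_root_vec_boundary[OF pq] by blast
  have "(- k) $ i $ j > 0 \<Longrightarrow> l $ i $ j > 0" for i j
    using k(2)[of i j] l(3) by simp
  then have "\<forall>\<^sub>F e in at_right 0. \<forall>i j. e * (- k) $ i $ j \<le> l $ i $ j"
    by (rule eventually_multiple_below_plan[OF opt_plan[OF l(1)]])
  then show ?thesis
  proof (rule eventually_mono)
    fix e :: real assume e: "\<forall>i j. e * (- k) $ i $ j \<le> l $ i $ j"
    have "l + e *\<^sub>R k \<in> plans_on UNIV"
      using e by (auto simp: plans_on_def) (smt (verit))
    moreover have "(i, j) \<in> opt_support a w" if "(l + e *\<^sub>R k) $ i $ j > 0" for i j
    proof (rule ccontr)
      assume c: "(i, j) \<notin> opt_support a w"
      have "k $ i $ j = 0" "\<not> l $ i $ j > 0" using c k(2) l(3) by blast+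
      then show False using that by simp
    qed
    ultimately have "l + e *\<^sub>R k \<in> plans_on (opt_support a w)"
      by (rule plans_on_support)
    then show "w + e *\<^sub>R root_vec p q \<in> flow_cone (opt_support a w)"
      unfolding flow_cone_def by (rule image_eqI[rotated]) (simp add: boundary_add boundary_scaleR l k)
  qed
qed

text \<open>Scale the points of the ray at \<open>t = n + 1\<close> by \<open>1 / (n + 1)\<close>;
  the contribution of \<open>w\<close> vanishes in the limit.\<close>

lemma recession_direction:
  fixes C :: "'a::real_normed_vector set"
  assumes "closed C" "convex_cone C" "\<And>t. 0 \<le> t \<Longrightarrow> w + t *\<^sub>R r \<in> C"
  shows "r \<in> C"
proof (rule closed_sequentially[OF assms(1)])
  show "inverse (real (Suc n)) *\<^sub>R (w + real (Suc n) *\<^sub>R r) \<in> C" for n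
    using assms(2,3) by (intro convex_cone_scaleR) auto
  have "(\<lambda>n. inverse (real (Suc n)) *\<^sub>R w + r) \<longlonglongrightarrow> 0 *\<^sub>R w + r"
    by (intro tendsto_intros LIMSEQ_inverse_real_of_nat)
  then show "(\<lambda>n. inverse (real (Suc n)) *\<^sub>R (w + real (Suc n) *\<^sub>R r)) \<longlonglongrightarrow> r"
    by (simp add: scaleR_add_right del: of_nat_Suc)
qed

lemma flow_cone_self: "\<exists>l. opt a l \<and> boundary l = w \<Longrightarrow> w \<in> flow_cone (opt_support a w)"
  unfolding flow_cone_def using opt_plans_on_support by blast

lemma root_vec_sum_zero: "root_vec p q \<in> sum_zero_space"
  by (metis boundary_sum_zero boundary_unit_plan)

lemma subspace_sum_zero: "subspace sum_zero_space"
  by (auto simp: subspace_def sum_zero_space_def sum.distrib simp flip: sum_distrib_left)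

text \<open>Let \<open>t\<close> be the last time up to \<open>U\<close> at which all cones still
  contain the moved vector. If \<open>t < U\<close> and no support has shrunk, then \<open>p\<close>
  and \<open>q\<close> are still linked for every \<open>a\<close>, and a further small step stays
  in all cones.\<close>

lemma move_to_exit:
  assumes fin: "finite A"
    and ex: "\<And>a w. a \<in> A \<Longrightarrow> w \<in> sum_zero_space \<Longrightarrow> \<exists>l. opt a l \<and> boundary l = w"
    and w: "w \<in> sum_zero_space"
    and pq: "\<And>a. a \<in> A \<Longrightarrow> (p, q) \<in> linked (opt_support a w)"
    and U: "0 \<le> U"
  obtains t where "0 \<le> t" "t \<le> U"
    "\<And>a. a \<in> A \<Longrightarrow> w + t *\<^sub>R root_vec p q \<in> flow_cone (opt_support a w)"
    "t < U \<Longrightarrow> \<exists>a\<in>A. opt_support a (w + t *\<^sub>R root_vec p q) \<subset> opt_support a w"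
proof -
  let ?f = "\<lambda>t. w + t *\<^sub>R root_vec p q"
  define I where "I = {0..U} \<inter> ?f -` (\<Inter>a\<in>A. flow_cone (opt_support a w))"
  have "closed (?f -` (\<Inter>a\<in>A. flow_cone (opt_support a w)))"
    by (intro closed_vimage closed_INT ballI closed_flow_cone continuous_intros)
  then have "compact I"
    unfolding I_def by (intro compact_Int_closed) auto
  moreover have "0 \<in> I"
    using U flow_cone_self[OF ex[OF _ w]] by (auto simp: I_def)
  ultimately obtain t where t: "t \<in> I" "\<And>s. s \<in> I \<Longrightarrow> s \<le> t"
    using compact_attains_sup[of I] by blast
  have cone: "?f t \<in> flow_cone (opt_support a w)" if "a \<in> A" for a
    using t(1) that by (auto simp: I_def)
  have ftw: "?f t \<in> sum_zero_space"
    using w by (intro subspace_add subspace_sum_zero subspace_scale root_vec_sum_zero)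
  show ?thesis
  proof (rule that)
    show "0 \<le> t" "t \<le> U" using t(1) by (auto simp: I_def)
    show "\<And>a. a \<in> A \<Longrightarrow> ?f t \<in> flow_cone (opt_support a w)" by (rule cone)
    assume "t < U"
    show "\<exists>a\<in>A. opt_support a (?f t) \<subset> opt_support a w"
    proof (rule ccontr)
      assume "\<not> ?thesis"
      then have eq: "opt_support a (?f t) = opt_support a w" if "a \<in> A" for a
        using opt_support_mono[OF ex[OF that w] cone[OF that]] that by blast
      have "\<forall>\<^sub>F e in at_right 0. ?f t + e *\<^sub>R root_vec p q \<in> flow_cone (opt_support a w)" if "a \<in> A" for a
        using eventually_move_in_flow_cone[OF ex[OF that ftw], of p q] pq[OF that] by (simp add: eq[OF that])
      then have "\<forall>\<^sub>F e in at_right 0. \<forall>a\<in>A. ?f t + e *\<^sub>R root_vec p q \<in> flow_cone (opt_support a w)"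
        using fin by (intro eventually_ball_finite) auto
      moreover have "\<forall>\<^sub>F e in at_right 0. e * 1 < U - t"
        using \<open>t < U\<close> by (intro eventually_small_multiple) simp
      ultimately have "\<forall>\<^sub>F e in at_right 0. (\<forall>a\<in>A. ?f t + e *\<^sub>R root_vec p q \<in> flow_cone (opt_support a w))
          \<and> e * 1 < U - t"
        by (rule eventually_conj)
      then obtain e where e: "0 < e" "\<forall>a\<in>A. ?f t + e *\<^sub>R root_vec p q \<in> flow_cone (opt_support a w)" "e < U - t"
        by (rule eventually_at_right_obtain) (use that in auto)
      have "t + e \<in> I"
        using e t(1) by (auto simp: I_def algebra_simps)
      then show False using t(2) e(1) by fastforce
    qed
  qed
qed

lemma exists_pos_neg:
  assumes "w \<in> sum_zero_space" "w \<noteq> 0"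
  obtains p q where "w $ p > 0" "w $ q < 0"
proof -
  have s: "(\<Sum>i\<in>UNIV. w $ i) = 0" using assms(1) by (simp add: sum_zero_space_def)
  have "\<exists>p. w $ p > 0"
  proof (rule ccontr)
    assume "\<not> ?thesis"
    then have "\<forall>i\<in>UNIV. - w $ i \<ge> 0" by (simp add: not_less)
    moreover have "(\<Sum>i\<in>UNIV. - w $ i) = 0" using s by (simp add: sum_negf)
    ultimately have "\<forall>i\<in>UNIV. - w $ i = 0" by (subst (asm) sum_nonneg_eq_0_iff) auto
    then show False using assms(2) by (simp add: vec_eq_iff)
  qed
  moreover have "\<exists>q. w $ q < 0"
  proof (rule ccontr)
    assume "\<not> ?thesis"
    then have "\<forall>i\<in>UNIV. w $ i \<ge> 0" by (simp add: not_less)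
    then have "\<forall>i\<in>UNIV. w $ i = 0" using s by (subst (asm) sum_nonneg_eq_0_iff) auto
    then show False using assms(2) by (simp add: vec_eq_iff)
  qed
  ultimately show ?thesis using that by blast
qed

text \<open>A Helly-type passage from pairs to all of \<open>A\<close>. Hypothesis
  \<open>unit\<close> is a triangle inequality: the direct edge is a cheapest way to realize its
  root.\<close>

lemma pairwise_common_opt_plan:
  fixes w :: "real ^ 'n"
  assumes fin: "finite A"
    and pair: "\<And>a b w. a \<in> A \<Longrightarrow> b \<in> A \<Longrightarrow> w \<in> sum_zero_space \<Longrightarrow>
                 \<exists>l. opt a l \<and> opt b l \<and> boundary l = w"
    and unit: "\<And>a p q. a \<in> A \<Longrightarrow> opt a (unit_plan p q)"
    and w: "w \<in> sum_zero_space"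
  shows "\<exists>l\<in>plans_on UNIV. boundary l = w \<and> (\<forall>a\<in>A. opt a l)"
  using w
proof (induction "(\<Sum>a\<in>A. card (opt_support a w)) + card {i. w $ i \<noteq> 0}" arbitrary: w rule: less_induct)
  case less
  note w = less.prems
  have ex: "\<exists>l. opt a l \<and> boundary l = w" if "a \<in> A" "w \<in> sum_zero_space" for a and w :: "real ^ 'n"
    using pair[OF that(1) that] by blast
  \<comment> \<open>The induction hypothesis in usable form: by monotonicity of supports, the common
    plan for the smaller \<open>v\<close> runs on edges admissible for \<open>w\<close>.\<close>
  have ext: "\<exists>l. boundary l = v \<and> l \<in> plans_on UNIV \<and> (\<forall>a\<in>A. l \<in> plans_on (opt_support a w))"
    if v: "v \<in> sum_zero_space" "\<And>a. a \<in> A \<Longrightarrow> v \<in> flow_cone (opt_support a w)"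
      and sub: "{i. v $ i \<noteq> 0} \<subseteq> {i. w $ i \<noteq> 0}"
      and strict: "{i. v $ i \<noteq> 0} \<subset> {i. w $ i \<noteq> 0} \<or> (\<exists>a\<in>A. opt_support a v \<subset> opt_support a w)" for v
  proof -
    have mono: "opt_support a v \<subseteq> opt_support a w" if "a \<in> A" for a
      by (rule opt_support_mono[OF ex[OF that w] v(2)[OF that]])
    have le1: "(\<Sum>a\<in>A. card (opt_support a v)) \<le> (\<Sum>a\<in>A. card (opt_support a w))"
      by (intro sum_mono card_mono mono) simp
    have le2: "card {i. v $ i \<noteq> 0} \<le> card {i. w $ i \<noteq> 0}"
      by (intro card_mono sub) simp
    from strict have "(\<Sum>a\<in>A. card (opt_support a v)) + card {i. v $ i \<noteq> 0}
        < (\<Sum>a\<in>A. card (opt_support a w)) + card {i. w $ i \<noteq> 0}"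
    proof
      assume "{i. v $ i \<noteq> 0} \<subset> {i. w $ i \<noteq> 0}"
      then have "card {i. v $ i \<noteq> 0} < card {i. w $ i \<noteq> 0}"
        by (intro psubset_card_mono) auto
      then show ?thesis using le1 by simp
    next
      assume "\<exists>a\<in>A. opt_support a v \<subset> opt_support a w"
      then obtain a where a: "a \<in> A" "opt_support a v \<subset> opt_support a w" by blast
      have "(\<Sum>a\<in>A. card (opt_support a v)) < (\<Sum>a\<in>A. card (opt_support a w))"
      proof (rule sum_strict_mono_ex1[OF fin])
        show "\<forall>a\<in>A. card (opt_support a v) \<le> card (opt_support a w)"
          by (intro ballI card_mono mono) auto
        show "\<exists>a\<in>A. card (opt_support a v) < card (opt_support a w)"
          using a by (intro bexI[of _ a] psubset_card_mono) auto
      qed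
      then show ?thesis using le2 by simp
    qed
    then obtain l where l: "l \<in> plans_on UNIV" "boundary l = v" "\<And>a. a \<in> A \<Longrightarrow> opt a l"
      using less.hyps[of v] v(1) by blast
    have "l \<in> plans_on (opt_support a w)" if "a \<in> A" for a
      by (rule plans_on_mono[OF opt_plans_on_support[OF l(3)[OF that] l(2)] mono[OF that]])
    then show ?thesis using l by blast
  qed
  \<comment> \<open>Optimality is automatic on admissible edges, so only the boundary and the edges
    matter from here on.\<close>
  have goal: ?case if "boundary l = w" "l \<in> plans_on UNIV" "\<And>a. a \<in> A \<Longrightarrow> l \<in> plans_on (opt_support a w)" for l
    using that opt_on_support ex w by blast
  show ?case
  proof (cases "w = 0")
    case True
    then show ?thesis
      by (intro goal[of 0]) (simp_all add: linear_0[OF linear_boundary] plans_on_zero)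
  next
    case False
    then obtain p q where p: "w $ p > 0" and q: "w $ q < 0"
      using exists_pos_neg w by blast
    show ?thesis
    proof (cases "\<exists>a\<in>A. (p, q) \<notin> linked (opt_support a w)")
      case True
      then obtain a where a: "a \<in> A" "(p, q) \<notin> linked (opt_support a w)" by blast
      define B where "B = {i. (p, i) \<in> linked (opt_support a w)}"
      have B: "i \<in> B \<longleftrightarrow> j \<in> B" if ij: "(i, j) \<in> opt_support a w" for i j
        unfolding B_def mem_Collect_eq
        using ij by (meson UnI1 UnI2 converse_iff rtrancl.rtrancl_into_rtrancl)
      have pB: "p \<in> B" and qB: "q \<notin> B" using a by (auto simp: B_def)
      \<comment> \<open>\<open>B\<close> is a component for \<open>a\<close> only. A plan shared by
        \<open>a\<close> and \<open>b\<close> uses edges of \<open>a\<close>, so it does not cross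
        \<open>B\<close>, and it is also optimal for \<open>b\<close>.\<close>
      have cone: "restrict_vec C w \<in> flow_cone (opt_support b w)" if b: "b \<in> A" and C: "C = B \<or> C = - B" for b C
      proof -
        obtain l where l: "opt a l" "opt b l" "boundary l = w"
          using pair[OF a(1) b w] by blast
        have "(i, j) \<in> opt_support a w" if "l $ i $ j \<noteq> 0" for i j
          using that opt_plans_on_support[OF l(1,3)] by (auto simp: plans_on_def)
        then have "i \<in> C \<longleftrightarrow> j \<in> C" if "l $ i $ j \<noteq> 0" for i j
          using B that C by blast
        then show ?thesis
          using restrict_in_flow_cone[OF opt_plans_on_support[OF l(2,3)], of C] l(3) by simp
      qed
      have "\<exists>l. boundary l = restrict_vec C w \<and> l \<in> plans_on UNIV \<and> (\<forall>a\<in>A. l \<in> plans_on (opt_support a w))"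
        if C: "C = B \<or> C = - B" for C
      proof (rule ext)
        show "restrict_vec C w \<in> sum_zero_space"
          using cone[OF a(1) C] boundary_sum_zero by (auto simp: flow_cone_def)
        show "restrict_vec C w \<in> flow_cone (opt_support b w)" if "b \<in> A" for b
          using cone that C by blast
        show "{i. restrict_vec C w $ i \<noteq> 0} \<subseteq> {i. w $ i \<noteq> 0}"
          by (auto simp: restrict_vec_def)
        then show "{i. restrict_vec C w $ i \<noteq> 0} \<subset> {i. w $ i \<noteq> 0}
          \<or> (\<exists>a\<in>A. opt_support a (restrict_vec C w) \<subset> opt_support a w)"
        proof (intro disjI1 psubsetI)
          \<comment> \<open>Each half loses \<open>p\<close> or \<open>q\<close>, both of which are
            nonzero coordinates of \<open>w\<close>.\<close>
          have "restrict_vec C w $ p = 0 \<or> restrict_vec C w $ q = 0"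
            using pB qB C by (auto simp: restrict_vec_def)
          then show "{i. restrict_vec C w $ i \<noteq> 0} \<noteq> {i. w $ i \<noteq> 0}"
            using p q by (metis (mono_tags, lifting) less_irrefl mem_Collect_eq)
        qed
      qed
      from this[of B] this[of "- B"] obtain l1 l2 where
        "boundary l1 = restrict_vec B w" "l1 \<in> plans_on UNIV" "\<And>a. a \<in> A \<Longrightarrow> l1 \<in> plans_on (opt_support a w)"
        "boundary l2 = restrict_vec (- B) w" "l2 \<in> plans_on UNIV" "\<And>a. a \<in> A \<Longrightarrow> l2 \<in> plans_on (opt_support a w)"
        by blast
      then show ?thesis
        by (intro goal[of "l1 + l2"]) (auto simp: boundary_add restrict_vec_add_Compl intro: plans_on_add)
    next
      case False
      then have pq: "\<And>a. a \<in> A \<Longrightarrow> (p, q) \<in> linked (opt_support a w)" by blast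
      then have qp: "\<And>a. a \<in> A \<Longrightarrow> (q, p) \<in> linked (opt_support a w)"
        by (blast intro: linked_sym)
      have move: "w + t *\<^sub>R root_vec i j \<in> sum_zero_space" for t i j
        using w by (intro subspace_add subspace_sum_zero subspace_scale root_vec_sum_zero)
      have supp: "{k. (w + t *\<^sub>R root_vec i j) $ k \<noteq> 0} \<subseteq> {k. w $ k \<noteq> 0}"
        if "{i, j} = {p, q}" for t i j
      proof -
        have "w $ i \<noteq> 0" "w $ j \<noteq> 0" using that p q by (auto simp: doubleton_eq_iff)
        then show ?thesis by (auto simp: root_vec_nth)
      qed
      have pnq: "p \<noteq> q" using p q by auto
      \<comment> \<open>This direction lowers coordinate \<open>p\<close>, which vanishes at the cap
        \<open>w $ p\<close>. Reaching the cap loses a coordinate; stopping earlier loses an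
        edge.\<close>
      obtain t1 where t1: "0 \<le> t1" "t1 \<le> w $ p"
        "\<And>a. a \<in> A \<Longrightarrow> w + t1 *\<^sub>R root_vec q p \<in> flow_cone (opt_support a w)"
        "t1 < w $ p \<Longrightarrow> \<exists>a\<in>A. opt_support a (w + t1 *\<^sub>R root_vec q p) \<subset> opt_support a w"
        by (rule move_to_exit[OF fin ex w qp less_imp_le[OF p]]) (assumption, assumption, assumption, rule that)
      have "(w + w $ p *\<^sub>R root_vec q p) $ p = 0"
        using pnq by (simp add: root_vec_nth)
      then have "{k. (w + t1 *\<^sub>R root_vec q p) $ k \<noteq> 0} \<noteq> {k. w $ k \<noteq> 0}" if "\<not> t1 < w $ p"
        using that t1(2) p by force
      then have "{k. (w + t1 *\<^sub>R root_vec q p) $ k \<noteq> 0} \<subset> {k. w $ k \<noteq> 0}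
          \<or> (\<exists>a\<in>A. opt_support a (w + t1 *\<^sub>R root_vec q p) \<subset> opt_support a w)"
        using t1(4) supp[of q p t1] by blast
      from ext[OF move t1(3) supp this] obtain l1 where
        l1: "boundary l1 = w + t1 *\<^sub>R root_vec q p" "l1 \<in> plans_on UNIV"
          "\<And>a. a \<in> A \<Longrightarrow> l1 \<in> plans_on (opt_support a w)"
        by auto
      show ?thesis
      proof (cases "\<forall>a\<in>A. (p, q) \<in> opt_support a w")
        case True
        \<comment> \<open>The direct edge is admissible for every \<open>a\<close>, so sending
          \<open>t1\<close> along it undoes the move.\<close>
        show ?thesis
        proof (rule goal)
          show "boundary (l1 + t1 *\<^sub>R unit_plan p q) = w"
            by (simp add: boundary_add boundary_scaleR boundary_unit_plan l1 root_vec_swap[of q p])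
          show "l1 + t1 *\<^sub>R unit_plan p q \<in> plans_on UNIV"
            using l1 t1 by (intro plans_on_add plans_on_scaleR plans_on_unit) auto
          show "l1 + t1 *\<^sub>R unit_plan p q \<in> plans_on (opt_support a w)" if "a \<in> A" for a
            using l1 t1 True that by (intro plans_on_add plans_on_scaleR plans_on_unit) auto
        qed
      next
        case False
        then obtain a where a: "a \<in> A" "(p, q) \<notin> opt_support a w" by blast
        \<comment> \<open>Otherwise monotonicity would make the edge of the optimal
          \<open>unit_plan p q\<close> admissible for \<open>a\<close> at \<open>w\<close>.\<close>
        have "root_vec p q \<notin> flow_cone (opt_support a w)"
        proof
          assume "root_vec p q \<in> flow_cone (opt_support a w)"
          then have "opt_support a (root_vec p q) \<subseteq> opt_support a w"
            by (rule opt_support_mono[OF ex[OF a(1) w]])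
          moreover have "(p, q) \<in> opt_support a (root_vec p q)"
            using unit[OF a(1), of p q] boundary_unit_plan[of p q]
            unfolding opt_support_def by (auto intro!: exI[of _ "unit_plan p q"] simp: unit_plan_nth)
          ultimately show False using a(2) by blast
        qed
        \<comment> \<open>The opposite direction is not a recession direction of this cone, so the
          move leaves it by time \<open>U\<close>. It must then stop before \<open>U\<close>, and
          some support loses an edge.\<close>
        then obtain U where U: "0 \<le> U" "w + U *\<^sub>R root_vec p q \<notin> flow_cone (opt_support a w)"
          using recession_direction[OF closed_flow_cone convex_cone_flow_cone, of w "root_vec p q" "opt_support a w"]
          by blast
        obtain t2 where t2: "0 \<le> t2" "t2 \<le> U"
          "\<And>a. a \<in> A \<Longrightarrow> w + t2 *\<^sub>R root_vec p q \<in> flow_cone (opt_support a w)"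
          "t2 < U \<Longrightarrow> \<exists>a\<in>A. opt_support a (w + t2 *\<^sub>R root_vec p q) \<subset> opt_support a w"
          by (rule move_to_exit[OF fin ex w pq U(1)]) (assumption, assumption, assumption, rule that)
        have "t2 \<noteq> U" using t2(3)[OF a(1)] U(2) by blast
        then have "\<exists>a\<in>A. opt_support a (w + t2 *\<^sub>R root_vec p q) \<subset> opt_support a w"
          using t2(2,4) by simp
        from ext[OF move t2(3) supp disjI2[OF this]] obtain l2 where
          l2: "boundary l2 = w + t2 *\<^sub>R root_vec p q" "l2 \<in> plans_on UNIV"
            "\<And>a. a \<in> A \<Longrightarrow> l2 \<in> plans_on (opt_support a w)"
          by auto
        show ?thesis
        proof (cases "t1 = 0")
          case True
          then show ?thesis using l1 by (intro goal[of l1]) auto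
        next
          case False
          then have pos: "t1 + t2 > 0" using t1 t2 by simp
          \<comment> \<open>Weights \<open>t2\<close> and \<open>t1\<close> cancel the two opposite
            moves. Treating \<open>t1 = 0\<close> separately keeps the denominator positive.\<close>
          let ?l = "inverse (t1 + t2) *\<^sub>R (t2 *\<^sub>R l1 + t1 *\<^sub>R l2)"
          have "t2 *\<^sub>R boundary l1 + t1 *\<^sub>R boundary l2 = (t1 + t2) *\<^sub>R w"
            by (simp add: l1 l2 root_vec_swap[of q p] algebra_simps)
          then have "boundary ?l = w"
            using pos by (simp add: boundary_add boundary_scaleR)
          then show ?thesis
            using l1 l2 t1 t2 by (intro goal[of ?l]) (auto intro!: plans_on_add plans_on_scaleR)
        qed
      qed
    qed
  qed
qed

section \<open>Duality for alcoved polytopes\<close>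

definition tight :: "real ^ 'n ^ 'n \<Rightarrow> real ^ 'n \<Rightarrow> ('n \<times> 'n) set" where
  "tight a x = {(i, j). x $ i - x $ j = a $ i $ j}"

text \<open>The orthogonal projection onto \<open>sum_zero_space\<close>. Normal cones contain
  functionals on the whole space, but on the polytope \<open>c\<close> and \<open>centre c\<close>
  agree.\<close>

definition centre :: "real ^ 'n \<Rightarrow> real ^ 'n" where
  "centre c = (\<chi> i. c $ i - (\<Sum>j\<in>UNIV. c $ j) / real CARD('n))"

lemma centre_sum_zero: "centre c \<in> sum_zero_space"
  by (simp add: centre_def sum_zero_space_def sum_subtractf)

lemma inner_centre:
  assumes "y \<in> sum_zero_space"
  shows "centre c \<bullet> y = c \<bullet> y"
proof -
  have "centre c \<bullet> y = (\<Sum>i\<in>UNIV. c $ i * y $ i) - (\<Sum>i\<in>UNIV. (\<Sum>j\<in>UNIV. c $ j) / real CARD('a) * y $ i)"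
    by (simp add: centre_def inner_vec_def left_diff_distrib sum_subtractf)
  also have "(\<Sum>i\<in>UNIV. (\<Sum>j\<in>UNIV. c $ j) / real CARD('a) * y $ i) = 0"
    by (subst sum_distrib_left[symmetric]) (use assms in \<open>simp add: sum_zero_space_def\<close>)
  finally show ?thesis by (simp add: inner_vec_def)
qed

section \<open>Alcoved polytopes as nonempty compact convex sets\<close>

lemma alcoved_le:
  "a \<in> minimal_params \<Longrightarrow> x \<in> alcoved a \<Longrightarrow> x $ i - x $ j \<le> a $ i $ j"
  by (cases "i = j") (auto simp: minimal_params_def param_space_def alcoved_def)

lemma alcoved_sum_zero: "x \<in> alcoved a \<Longrightarrow> x \<in> sum_zero_space"
  by (simp add: alcoved_def)

text \<open>With a single index \<open>defines_minimally\<close> is vacuous, so the origin is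
  supplied separately.\<close>

lemma alcoved_nonempty:
  fixes a :: "real ^ 'n ^ 'n"
  assumes "a \<in> minimal_params"
  shows "alcoved a \<noteq> {}"
proof (cases "\<exists>i j :: 'n. i \<noteq> j")
  case True
  then show ?thesis
    using assms by (auto simp: minimal_params_def defines_minimally_def)
next
  case False
  then have "0 \<in> alcoved a"
    by (simp add: alcoved_def sum_zero_space_def)
  then show ?thesis by blast
qed

lemma minimal_attained:
  assumes "a \<in> minimal_params"
  obtains x where "x \<in> alcoved a" "x $ i - x $ j = a $ i $ j"
proof (cases "i = j")
  case True
  then have "a $ i $ j = 0"
    using assms by (simp add: minimal_params_def param_space_def)
  then show ?thesis
    using alcoved_nonempty[OF assms] True that by auto
next
  case False
  then have "\<exists>x\<in>alcoved a. a $ i $ j = x $ i - x $ j"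
    using assms unfolding minimal_params_def defines_minimally_def by blast
  then show ?thesis using that by auto
qed

lemma alcoved_eq_Inter:
  "alcoved a = {x. (\<Sum>i\<in>UNIV. x $ i) = 0} \<inter> (\<Inter>i. \<Inter>j\<in>- {i}. {x. x $ i - x $ j \<le> a $ i $ j})"
  by (auto simp: alcoved_def sum_zero_space_def)

lemma closed_alcoved: "closed (alcoved a)"
  unfolding alcoved_eq_Inter
  by (intro closed_Int closed_INT ballI closed_Collect_eq closed_Collect_le continuous_intros)

lemma convex_alcoved: "convex (alcoved a)"
proof (rule convexI)
  fix x y :: "real ^ 'a" and u v :: real
  assume xy: "x \<in> alcoved a" "y \<in> alcoved a" and uv: "0 \<le> u" "0 \<le> v" "u + v = 1"
  have "(u *\<^sub>R x + v *\<^sub>R y) $ i - (u *\<^sub>R x + v *\<^sub>R y) $ j \<le> a $ i $ j" if "i \<noteq> j" for i j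
  proof -
    have "u * (x $ i - x $ j) + v * (y $ i - y $ j) \<le> a $ i $ j"
      using xy uv that by (intro convex_bound_le) (auto simp: alcoved_def)
    then show ?thesis by (simp add: algebra_simps)
  qed
  moreover have "u *\<^sub>R x + v *\<^sub>R y \<in> sum_zero_space"
    using xy by (intro subspace_add subspace_scale subspace_sum_zero alcoved_sum_zero)
  ultimately show "u *\<^sub>R x + v *\<^sub>R y \<in> alcoved a"
    by (simp add: alcoved_def)
qed

text \<open>Bounds on differences bound coordinates: summing \<open>x $ i - x $ j\<close> over
  \<open>j\<close> gives \<open>CARD('n)\<close> times \<open>x $ i\<close>, as the coordinates sum
  to zero.\<close>

lemma compact_alcoved:
  fixes a :: "real ^ 'n ^ 'n"
  assumes "a \<in> minimal_params"
  shows "compact (alcoved a)"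
proof -
  define M where "M = (\<Sum>i\<in>UNIV. \<Sum>j\<in>UNIV. \<bar>a $ i $ j\<bar>)"
  have "norm x \<le> real CARD('n) * M" if x: "x \<in> alcoved a" for x
  proof -
    have M: "\<bar>a $ i $ j\<bar> \<le> M" for i j
    proof -
      have "\<bar>a $ i $ j\<bar> \<le> (\<Sum>j\<in>UNIV. \<bar>a $ i $ j\<bar>)"
        by (rule member_le_sum) auto
      also have "\<dots> \<le> M"
        unfolding M_def by (rule member_le_sum[of i]) (auto intro: sum_nonneg)
      finally show ?thesis .
    qed
    have diff: "x $ i - x $ j \<le> M" for i j
      using alcoved_le[OF assms x, of i j] M[of i j] by linarith
    have "\<bar>x $ i\<bar> \<le> M" for i
    proof -
      have s: "(\<Sum>j\<in>UNIV. x $ i - x $ j) = real CARD('n) * x $ i"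
        using alcoved_sum_zero[OF x] by (simp add: sum_subtractf sum_zero_space_def)
      have "(\<Sum>j\<in>UNIV. x $ i - x $ j) \<le> (\<Sum>j\<in>(UNIV::'n set). M)"
        by (intro sum_mono diff)
      moreover have "(\<Sum>j\<in>(UNIV::'n set). - M) \<le> (\<Sum>j\<in>UNIV. x $ i - x $ j)"
        using diff by (intro sum_mono) (smt (verit))
      ultimately have "real CARD('n) * x $ i \<le> real CARD('n) * M" "real CARD('n) * - M \<le> real CARD('n) * x $ i"
        using s by (simp_all add: sum_negf)
      then have "x $ i \<le> M" "- M \<le> x $ i"
        by (simp_all only: mult_le_cancel_left_pos of_nat_0_less_iff zero_less_card_finite)
      then show ?thesis by linarith
    qed
    then have "(\<Sum>i\<in>UNIV. \<bar>x $ i\<bar>) \<le> (\<Sum>i\<in>(UNIV::'n set). M)"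
      by (intro sum_mono)
    then show ?thesis
      using norm_le_l1_cart[of x] by simp
  qed
  then have "bounded (alcoved a)"
    by (auto simp: bounded_iff)
  then show ?thesis
    by (simp add: compact_eq_bounded_closed closed_alcoved)
qed

lemma exists_maximizer:
  assumes "a \<in> minimal_params"
  obtains x where "x \<in> alcoved a" "\<And>y. y \<in> alcoved a \<Longrightarrow> w \<bullet> y \<le> w \<bullet> x"
proof -
  have "continuous_on (alcoved a) (\<lambda>y. w \<bullet> y)"
    by (intro continuous_intros)
  from continuous_attains_sup[OF compact_alcoved[OF assms] alcoved_nonempty[OF assms] this]
  show ?thesis using that by blast
qed

section \<open>Weak duality, Farkas and complementary slackness\<close>

lemma weak_duality:
  assumes a: "a \<in> minimal_params" and x: "x \<in> alcoved a" and l: "l \<in> plans_on T"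
  shows "boundary l \<bullet> x \<le> l \<bullet> a"
  unfolding inner_boundary inner_plan
  by (intro sum_mono mult_left_mono alcoved_le[OF a x] plans_on_nonneg[OF l])

lemma tight_cost:
  assumes "l \<in> plans_on (tight a x)"
  shows "boundary l \<bullet> x = l \<bullet> a"
  unfolding inner_boundary inner_plan
proof (intro sum.cong refl)
  fix i j
  show "l $ i $ j * (x $ i - x $ j) = l $ i $ j * a $ i $ j"
    using assms by (cases "l $ i $ j = 0") (auto simp: plans_on_def tight_def)
qed

text \<open>Such a plan attains the bound of weak duality at \<open>x\<close>.\<close>

lemma opt_on_tight:
  assumes a: "a \<in> minimal_params" and x: "x \<in> alcoved a" and l: "l \<in> plans_on (tight a x)"
  shows "opt a l"
  unfolding opt_def
proof (intro conjI ballI impI)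
  show "l \<in> plans_on UNIV" using l by (rule plans_on_mono) simp
  fix m assume "m \<in> plans_on UNIV" "boundary m = boundary l"
  then show "l \<bullet> a \<le> m \<bullet> a"
    using weak_duality[OF a x, of m UNIV] tight_cost[OF l] by simp
qed

text \<open>Minimality of the parameters provides a point at which the constraint of the edge is
  tight.\<close>

lemma opt_unit_plan:
  assumes a: "a \<in> minimal_params"
  shows "opt a (unit_plan p q)"
proof -
  obtain x where "x \<in> alcoved a" "x $ p - x $ q = a $ p $ q"
    by (rule minimal_attained[OF a])
  then show ?thesis
    by (intro opt_on_tight[OF a] plans_on_unit) (auto simp: tight_def)
qed

text \<open>Slack constraints survive a small step, and tight ones do not get worse along
  \<open>y\<close>. Those with \<open>y $ i < y $ j\<close> become slack, which gives the inclusion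
  of tight sets.\<close>

lemma move_in_alcoved:
  fixes a :: "real ^ 'n ^ 'n"
  assumes a: "a \<in> minimal_params" and x: "x \<in> alcoved a" and y: "y \<in> sum_zero_space"
    and le: "\<And>i j. (i, j) \<in> tight a x \<Longrightarrow> y $ i \<le> y $ j"
  obtains e where "0 < e" "x + e *\<^sub>R y \<in> alcoved a" "tight a (x + e *\<^sub>R y) \<subseteq> {(i, j) \<in> tight a x. y $ i = y $ j}"
proof -
  have "\<forall>\<^sub>F e in at_right 0. (i, j) \<notin> tight a x \<longrightarrow> e * (y $ i - y $ j) < a $ i $ j - (x $ i - x $ j)" for i j
  proof (cases "(i, j) \<in> tight a x")
    case False
    then have "0 < a $ i $ j - (x $ i - x $ j)"
      using alcoved_le[OF a x, of i j] by (simp add: tight_def)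
    from eventually_small_multiple[OF this, of "y $ i - y $ j"] show ?thesis
      by (rule eventually_mono) simp
  qed simp
  then have "\<forall>\<^sub>F e in at_right 0. \<forall>i j. (i, j) \<notin> tight a x \<longrightarrow> e * (y $ i - y $ j) < a $ i $ j - (x $ i - x $ j)"
    by (intro eventually_all_finite)
  then obtain e :: real where e: "0 < e"
    and lt: "\<And>i j. (i, j) \<notin> tight a x \<Longrightarrow> e * (y $ i - y $ j) < a $ i $ j - (x $ i - x $ j)"
    by (rule eventually_at_right_obtain) (use that in blast)
  have diff: "(x + e *\<^sub>R y) $ i - (x + e *\<^sub>R y) $ j = (x $ i - x $ j) + e * (y $ i - y $ j)" for i j
    by (simp add: algebra_simps)
  have cases: "(x + e *\<^sub>R y) $ i - (x + e *\<^sub>R y) $ j < a $ i $ j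
      \<or> ((i, j) \<in> tight a x \<and> y $ i = y $ j \<and> (x + e *\<^sub>R y) $ i - (x + e *\<^sub>R y) $ j = a $ i $ j)" for i j
  proof (cases "(i, j) \<in> tight a x")
    case True
    then have t: "x $ i - x $ j = a $ i $ j" by (simp add: tight_def)
    show ?thesis
    proof (cases "y $ i = y $ j")
      case False
      then have "y $ i - y $ j < 0" using le[OF True] by simp
      then have "e * (y $ i - y $ j) < 0" using e by (simp add: mult_pos_neg)
      then show ?thesis unfolding diff t by simp
    qed (use True t diff in simp)
  next
    case False
    then show ?thesis unfolding diff using lt[of i j] by simp
  qed
  show ?thesis
  proof (rule that[OF e])
    have "x + e *\<^sub>R y \<in> sum_zero_space"
      using alcoved_sum_zero[OF x] y by (intro subspace_add subspace_scale subspace_sum_zero)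
    moreover have "(x + e *\<^sub>R y) $ i - (x + e *\<^sub>R y) $ j \<le> a $ i $ j" for i j
      using cases[of i j] by linarith
    ultimately show "x + e *\<^sub>R y \<in> alcoved a"
      by (simp add: alcoved_def)
    show "tight a (x + e *\<^sub>R y) \<subseteq> {(i, j) \<in> tight a x. y $ i = y $ j}"
    proof
      fix z assume z: "z \<in> tight a (x + e *\<^sub>R y)"
      then show "z \<in> {(i, j) \<in> tight a x. y $ i = y $ j}"
        using cases[of "fst z" "snd z"] by (auto simp: tight_def[of a "x + e *\<^sub>R y"])
    qed
  qed
qed

text \<open>Separate \<open>w\<close> from the closed cone by \<open>c\<close>; scaling the
  generators replaces the threshold \<open>b\<close> by zero. The direction is \<open>- c\<close>,
  projected into \<open>sum_zero_space\<close> so that polytope points can be moved along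
  it.\<close>

lemma farkas_sum_zero:
  fixes w :: "real ^ 'n"
  assumes fin: "finite G" and G: "G \<subseteq> sum_zero_space" and w: "w \<in> sum_zero_space"
    and nin: "w \<notin> convex_cone hull G"
  obtains y where "y \<in> sum_zero_space" "\<And>g. g \<in> G \<Longrightarrow> g \<bullet> y \<le> 0" "w \<bullet> y > 0"
proof -
  obtain c b where c: "c \<bullet> w < b" "\<And>x. x \<in> convex_cone hull G \<Longrightarrow> c \<bullet> x > b"
    using separating_hyperplane_closed_point[OF convex_convex_cone_hull closed_convex_cone_hull[OF fin] nin]
    by blast
  have b: "b < 0"
    using c(2)[OF convex_cone_hull_contains_0] by simp
  have ge: "c \<bullet> g \<ge> 0" if g: "g \<in> G" for g
  proof (rule ccontr)
    assume "\<not> ?thesis"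
    then have neg: "c \<bullet> g < 0" by simp
    \<comment> \<open>This multiple has inner product exactly \<open>b\<close> with
      \<open>c\<close>, against the strict separation.\<close>
    have "(b / (c \<bullet> g)) *\<^sub>R g \<in> convex_cone hull G"
      using b neg by (intro convex_cone_hull_mul hull_inc g) (simp add: divide_nonpos_neg)
    from c(2)[OF this] show False using neg by simp
  qed
  have C: "v \<bullet> centre (- c) = - (c \<bullet> v)" if "v \<in> sum_zero_space" for v
    using inner_centre[OF that, of "- c"] by (simp add: inner_commute)
  show ?thesis
  proof (rule that[of "centre (- c)"])
    show "centre (- c) \<in> sum_zero_space" by (rule centre_sum_zero)
    show "g \<bullet> centre (- c) \<le> 0" if "g \<in> G" for g
      using ge[OF that] C G that by (metis neg_le_0_iff_le subsetD)
    show "w \<bullet> centre (- c) > 0" using C[OF w] c(1) b by simp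
  qed
qed

text \<open>Otherwise Farkas gives a direction that violates no tight constraint and increases
  \<open>w\<close>, so \<open>x\<close> could be improved.\<close>

lemma maximizer_in_flow_cone:
  assumes a: "a \<in> minimal_params" and x: "x \<in> alcoved a" and w: "w \<in> sum_zero_space"
    and max: "\<And>y. y \<in> alcoved a \<Longrightarrow> w \<bullet> y \<le> w \<bullet> x"
  shows "w \<in> flow_cone (tight a x)"
proof (rule ccontr)
  let ?G = "(\<lambda>(p, q). root_vec p q) ` tight a x"
  assume "w \<notin> flow_cone (tight a x)"
  then have "w \<notin> convex_cone hull ?G" by (simp add: flow_cone_eq_hull)
  then obtain y where y: "y \<in> sum_zero_space" "\<And>g. g \<in> ?G \<Longrightarrow> g \<bullet> y \<le> 0" "w \<bullet> y > 0"
    by (rule farkas_sum_zero[of ?G w, rotated 3]) (use w root_vec_sum_zero in auto)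
  have "y $ i \<le> y $ j" if "(i, j) \<in> tight a x" for i j
    using y(2)[of "root_vec i j"] that by (force simp: inner_root_vec)
  then obtain e where e: "0 < e" "x + e *\<^sub>R y \<in> alcoved a"
    by (rule move_in_alcoved[OF a x y(1)]) (use that in auto)
  from max[OF e(2)] show False
    using e(1) y(3) by (simp add: inner_add_right mult_le_0_iff)
qed

text \<open>Some plan on tight edges has the same boundary and cost
  \<open>boundary l \<bullet> x\<close>. So \<open>l\<close> costs no more, and a sum of nonnegative
  terms, amount times slack, must vanish.\<close>

lemma complementary_slackness:
  assumes a: "a \<in> minimal_params" and x: "x \<in> alcoved a" and l: "opt a l"
    and max: "\<And>y. y \<in> alcoved a \<Longrightarrow> boundary l \<bullet> y \<le> boundary l \<bullet> x"
  shows "l \<in> plans_on (tight a x)"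
proof -
  obtain m where m: "m \<in> plans_on (tight a x)" "boundary m = boundary l"
    using maximizer_in_flow_cone[OF a x boundary_sum_zero max] by (auto simp: flow_cone_def)
  have "l \<bullet> a \<le> boundary l \<bullet> x"
    using opt_le[OF l plans_on_mono[OF m(1)] m(2)] tight_cost[OF m(1)] m(2) by simp
  then have le: "(\<Sum>i\<in>UNIV. \<Sum>j\<in>UNIV. l $ i $ j * (a $ i $ j - (x $ i - x $ j))) \<le> 0"
    by (simp add: inner_boundary inner_plan right_diff_distrib sum_subtractf)
  have nn: "0 \<le> l $ i $ j * (a $ i $ j - (x $ i - x $ j))" for i j
    using plans_on_nonneg[OF opt_plan[OF l], of i j] alcoved_le[OF a x, of i j] by simp
  have "(\<Sum>i\<in>UNIV. \<Sum>j\<in>UNIV. l $ i $ j * (a $ i $ j - (x $ i - x $ j))) = 0"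
    using le by (intro antisym sum_nonneg nn)
  then have "\<forall>i. (\<Sum>j\<in>UNIV. l $ i $ j * (a $ i $ j - (x $ i - x $ j))) = 0"
    by (subst (asm) sum_nonneg_eq_0_iff) (auto intro: sum_nonneg nn)
  then have "\<forall>i j. l $ i $ j * (a $ i $ j - (x $ i - x $ j)) = 0"
    by (simp add: sum_nonneg_eq_0_iff nn)
  then have "(i, j) \<in> tight a x" if "l $ i $ j > 0" for i j
    using that by (simp add: tight_def) (metis less_irrefl)
  then show ?thesis
    by (rule plans_on_support[OF opt_plan[OF l]])
qed

section \<open>Tight sets, normal cones and the normal fan\<close>

lemma tight_iff_normal:
  assumes a: "a \<in> minimal_params" and x: "x \<in> alcoved a"
  shows "(i, j) \<in> tight a x \<longleftrightarrow> root_vec i j \<in> normal_cone (alcoved a) {x}"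
proof
  assume "(i, j) \<in> tight a x"
  then show "root_vec i j \<in> normal_cone (alcoved a) {x}"
    using alcoved_le[OF a] by (auto simp: normal_cone_def inner_root_vec tight_def)
next
  assume r: "root_vec i j \<in> normal_cone (alcoved a) {x}"
  obtain y where y: "y \<in> alcoved a" "y $ i - y $ j = a $ i $ j"
    by (rule minimal_attained[OF a])
  then have "a $ i $ j \<le> x $ i - x $ j"
    using r by (auto simp: normal_cone_def inner_root_vec)
  then show "(i, j) \<in> tight a x"
    using alcoved_le[OF a x, of i j] by (simp add: tight_def)
qed

text \<open>Duality for the functional \<open>centre c\<close>. Thus the tight set determines the
  normal cone, while \<open>tight_iff_normal\<close> recovers the tight set from it.\<close>

lemma normal_cone_iff:
  assumes a: "a \<in> minimal_params" and x: "x \<in> alcoved a"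
  shows "c \<in> normal_cone (alcoved a) {x} \<longleftrightarrow> centre c \<in> flow_cone (tight a x)"
proof
  assume "c \<in> normal_cone (alcoved a) {x}"
  then have "c \<bullet> y \<le> c \<bullet> x" if "y \<in> alcoved a" for y
    using that by (simp add: normal_cone_def)
  then have "centre c \<bullet> y \<le> centre c \<bullet> x" if "y \<in> alcoved a" for y
    using that x by (simp only: inner_centre[OF alcoved_sum_zero])
  then show "centre c \<in> flow_cone (tight a x)"
    by (rule maximizer_in_flow_cone[OF a x centre_sum_zero])
next
  assume "centre c \<in> flow_cone (tight a x)"
  then obtain l where l: "l \<in> plans_on (tight a x)" "centre c = boundary l"
    by (auto simp: flow_cone_def)
  have "c \<bullet> y \<le> c \<bullet> x" if y: "y \<in> alcoved a" for y
    using weak_duality[OF a y l(1)] tight_cost[OF l(1)]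
      inner_centre[OF alcoved_sum_zero[OF x], of c] inner_centre[OF alcoved_sum_zero[OF y], of c]
    unfolding l(2) by simp
  then show "c \<in> normal_cone (alcoved a) {x}"
    by (simp add: normal_cone_def)
qed

text \<open>Every nonempty face has a relatively interior point, and its normal cone can be computed
  at that point alone.\<close>

lemma normal_fan_eq_point_cones:
  assumes a: "a \<in> minimal_params"
  shows "normal_fan (alcoved a) = (\<lambda>x. normal_cone (alcoved a) {x}) ` alcoved a"
proof (intro subset_antisym subsetI)
  fix N assume "N \<in> normal_fan (alcoved a)"
  then obtain F where F: "F face_of alcoved a" "F \<noteq> {}" "N = normal_cone (alcoved a) F"
    by (auto simp: normal_fan_def)
  have cF: "convex F" using F(1) by (rule face_of_imp_convex)
  then obtain x where x: "x \<in> rel_interior F"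
    using F(2) rel_interior_eq_empty by blast
  have FP: "F \<subseteq> alcoved a" using F(1) by (rule face_of_imp_subset)
  have xF: "x \<in> F" using x rel_interior_subset by blast
  have "normal_cone (alcoved a) {x} \<subseteq> normal_cone (alcoved a) F"
  proof
    fix c assume c: "c \<in> normal_cone (alcoved a) {x}"
    have "c \<bullet> x \<le> c \<bullet> y" if y: "y \<in> F" for y
    proof -
      \<comment> \<open>The segment from \<open>y\<close> to \<open>x\<close> extends beyond
        \<open>x\<close> inside \<open>F\<close>; maximality of \<open>c\<close> at \<open>x\<close>
        then bounds \<open>c\<close> at \<open>y\<close> from below.\<close>
      obtain e where e: "e > 1" "(1 - e) *\<^sub>R y + e *\<^sub>R x \<in> F"
        using convex_rel_interior_if2[OF cF x] y hull_inc by metis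
      then have "c \<bullet> ((1 - e) *\<^sub>R y + e *\<^sub>R x) \<le> c \<bullet> x"
        using c FP by (auto simp: normal_cone_def)
      then have "(e - 1) * (c \<bullet> x) \<le> (e - 1) * (c \<bullet> y)"
        by (simp add: inner_add_right algebra_simps)
      then show ?thesis using e(1) by simp
    qed
    then show "c \<in> normal_cone (alcoved a) F"
      using c by (fastforce simp: normal_cone_def)
  qed
  moreover have "normal_cone (alcoved a) F \<subseteq> normal_cone (alcoved a) {x}"
    using xF by (auto simp: normal_cone_def)
  ultimately show "N \<in> (\<lambda>x. normal_cone (alcoved a) {x}) ` alcoved a"
    using F(3) xF FP by blast
next
  fix N assume "N \<in> (\<lambda>x. normal_cone (alcoved a) {x}) ` alcoved a"
  then obtain x where x: "x \<in> alcoved a" "N = normal_cone (alcoved a) {x}" by blast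
  \<comment> \<open>The smallest face containing \<open>x\<close>.\<close>
  define F where "F = {y \<in> alcoved a. tight a x \<subseteq> tight a y}"
  have xF: "x \<in> F" using x by (simp add: F_def)
  have "F face_of alcoved a"
    unfolding face_of_def
  proof (intro conjI ballI impI)
    show "F \<subseteq> alcoved a" by (auto simp: F_def)
    have aff: "u * s + (1 - u) * s' = t" if "s = t" "s' = t" for u s s' t :: real
      using that by (simp add: algebra_simps)
    show "convex F"
    proof (rule convexI)
      fix y z :: "real ^ 'a" and u v :: real
      assume yz: "y \<in> F" "z \<in> F" and uv: "0 \<le> u" "0 \<le> v" "u + v = 1"
      have v: "v = 1 - u" using uv by simp
      have "(i, j) \<in> tight a (u *\<^sub>R y + v *\<^sub>R z)" if "(i, j) \<in> tight a x" for i j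
      proof -
        have "y $ i - y $ j = a $ i $ j" "z $ i - z $ j = a $ i $ j"
          using yz that by (auto simp: F_def tight_def)
        from aff[OF this, of u] show ?thesis
          by (simp add: tight_def v algebra_simps)
      qed
      moreover have "u *\<^sub>R y + v *\<^sub>R z \<in> alcoved a"
        using yz uv by (intro convexD convex_alcoved) (auto simp: F_def)
      ultimately show "u *\<^sub>R y + v *\<^sub>R z \<in> F" by (auto simp: F_def)
    qed
    fix y z w assume yz: "y \<in> alcoved a" "z \<in> alcoved a" and w: "w \<in> F" "w \<in> open_segment y z"
    obtain u where u: "0 < u" "u < 1" "w = (1 - u) *\<^sub>R y + u *\<^sub>R z"
      using w(2) by (auto simp: in_segment)
    have "(i, j) \<in> tight a y \<and> (i, j) \<in> tight a z" if ij: "(i, j) \<in> tight a x" for i j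
    proof -
      define s where "s = a $ i $ j - (y $ i - y $ j)"
      define s' where "s' = a $ i $ j - (z $ i - z $ j)"
      have "w $ i - w $ j = a $ i $ j" using w(1) ij by (auto simp: F_def tight_def)
      then have "(1 - u) * s + u * s' = 0"
        unfolding s_def s'_def u(3) by (simp add: algebra_simps)
      moreover have "0 \<le> s" "0 \<le> s'"
        using alcoved_le[OF a] yz by (simp_all add: s_def s'_def)
      ultimately have "(1 - u) * s = 0" "u * s' = 0"
        using u by (simp_all add: add_nonneg_eq_0_iff)
      then have "s = 0" "s' = 0" using u by simp_all
      then show ?thesis
        by (simp add: s_def s'_def tight_def)
    qed
    then show "y \<in> F" "z \<in> F" using yz by (auto simp: F_def)
  qed
  moreover have "normal_cone (alcoved a) F = normal_cone (alcoved a) {x}"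
  proof
    show "normal_cone (alcoved a) F \<subseteq> normal_cone (alcoved a) {x}"
      using xF by (auto simp: normal_cone_def)
    show "normal_cone (alcoved a) {x} \<subseteq> normal_cone (alcoved a) F"
    proof
      fix c assume c: "c \<in> normal_cone (alcoved a) {x}"
      have "c \<bullet> x \<le> c \<bullet> y" if y: "y \<in> F" for y
      proof -
        have yP: "y \<in> alcoved a" using y by (simp add: F_def)
        \<comment> \<open>Constraints tight at \<open>x\<close> are constant along the line through
          \<open>x\<close> and \<open>y\<close>, so \<open>x\<close> can be pushed a little away
          from \<open>y\<close>.\<close>
        have "x - y \<in> sum_zero_space"
          using x(1) yP by (intro subspace_diff subspace_sum_zero alcoved_sum_zero)
        moreover have "(x - y) $ i \<le> (x - y) $ j" if "(i, j) \<in> tight a x" for i j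
        proof -
          have "x $ i - x $ j = a $ i $ j" "y $ i - y $ j = a $ i $ j"
            using y that by (auto simp: F_def tight_def)
          then show ?thesis by simp
        qed
        ultimately obtain e where e: "0 < e" "x + e *\<^sub>R (x - y) \<in> alcoved a"
          by (rule move_in_alcoved[OF a x(1)]) (use that in auto)
        then have "c \<bullet> (x + e *\<^sub>R (x - y)) \<le> c \<bullet> x"
          using c by (auto simp: normal_cone_def)
        then have "e * (c \<bullet> x) \<le> e * (c \<bullet> y)"
          by (simp add: inner_add_right inner_diff_right algebra_simps)
        then show ?thesis using e(1) by simp
      qed
      then show "c \<in> normal_cone (alcoved a) F"
        using c by (fastforce simp: normal_cone_def)
    qed
  qed
  ultimately show "N \<in> normal_fan (alcoved a)"
    using xF x(2) unfolding normal_fan_def by blast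
qed

text \<open>Let \<open>x\<close> maximize the boundary of \<open>l\<close> over
  \<open>alcoved a\<close>. Its normal cone is that of some point \<open>y\<close> of
  \<open>alcoved b\<close>, and equal normal cones give equal tight sets, on which \<open>l\<close>
  lives.\<close>

lemma same_fan_opt:
  assumes a: "a \<in> minimal_params" and b: "b \<in> minimal_params"
    and fan: "normal_fan (alcoved a) = normal_fan (alcoved b)" and l: "opt a l"
  shows "opt b l"
proof -
  obtain x where x: "x \<in> alcoved a" "\<And>y. y \<in> alcoved a \<Longrightarrow> boundary l \<bullet> y \<le> boundary l \<bullet> x"
    by (rule exists_maximizer[OF a]) (rule that)
  have "normal_cone (alcoved a) {x} \<in> normal_fan (alcoved b)"
    using x(1) fan normal_fan_eq_point_cones[OF a] by blast
  then obtain y where y: "y \<in> alcoved b" "normal_cone (alcoved a) {x} = normal_cone (alcoved b) {y}"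
    using normal_fan_eq_point_cones[OF b] by blast
  then have "tight a x = tight b y"
    using tight_iff_normal[OF a x(1)] tight_iff_normal[OF b y(1)] by auto
  then show ?thesis
    using complementary_slackness[OF a x(1) l x(2)] opt_on_tight[OF b y(1)] by simp
qed

text \<open>Put one unit on every tight edge. The boundary of this plan is maximized at
  \<open>x\<close>, so complementary slackness confines all its optimal plans to the tight
  edges.\<close>

lemma tight_eq_opt_support:
  assumes a: "a \<in> minimal_params" and x: "x \<in> alcoved a"
  shows "\<exists>w\<in>sum_zero_space. opt_support a w = tight a x"
proof -
  define l :: "real ^ 'a ^ 'a" where "l = (\<chi> i j. if (i, j) \<in> tight a x then 1 else 0)"
  have l: "l \<in> plans_on (tight a x)"
    by (auto simp: plans_on_def l_def)
  then have optl: "opt a l" by (rule opt_on_tight[OF a x])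
  have "boundary l \<bullet> y \<le> boundary l \<bullet> x" if "y \<in> alcoved a" for y
    using weak_duality[OF a that l] tight_cost[OF l] by simp
  then have "m \<in> plans_on (tight a x)" if "opt a m" "boundary m = boundary l" for m
    using complementary_slackness[OF a x that(1)] that(2) by simp
  then have "opt_support a (boundary l) \<subseteq> tight a x"
    unfolding opt_support_def plans_on_def by fastforce
  moreover have "tight a x \<subseteq> opt_support a (boundary l)"
    using optl unfolding opt_support_def by (auto intro!: exI[of _ l] simp: l_def)
  ultimately show ?thesis
    using boundary_sum_zero by blast
qed

lemma opt_exists:
  assumes a: "a \<in> minimal_params" and w: "w \<in> sum_zero_space"
  shows "\<exists>l. opt a l \<and> boundary l = w"
proof -
  obtain x where x: "x \<in> alcoved a" "\<And>y. y \<in> alcoved a \<Longrightarrow> w \<bullet> y \<le> w \<bullet> x"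
    by (rule exists_maximizer[OF a]) (rule that)
  then show ?thesis
    using maximizer_in_flow_cone[OF a x(1) w x(2)] opt_on_tight[OF a x(1)] by (auto simp: flow_cone_def)
qed

text \<open>Strict complementarity, a converse of \<open>tight_eq_opt_support\<close>. Among the
  maximizers of \<open>w\<close>, take one with the fewest tight constraints; Farkas then puts each
  of its tight edges into an optimal plan.\<close>

lemma opt_support_eq_tight:
  fixes a :: "real ^ 'n ^ 'n"
  assumes a: "a \<in> minimal_params" and w: "w \<in> sum_zero_space"
  shows "\<exists>x\<in>alcoved a. tight a x = opt_support a w"
proof -
  define M where "M = {x \<in> alcoved a. \<forall>y\<in>alcoved a. w \<bullet> y \<le> w \<bullet> x}"
  obtain x0 where "x0 \<in> M"
    by (rule exists_maximizer[OF a, of w]) (use M_def in blast)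
  then obtain x where xM: "x \<in> M" and min: "\<And>y. y \<in> M \<Longrightarrow> card (tight a x) \<le> card (tight a y)"
    using ex_has_least_nat[of "\<lambda>x. x \<in> M" x0 "\<lambda>x. card (tight a x)"] by blast
  then have x: "x \<in> alcoved a" "\<And>y. y \<in> alcoved a \<Longrightarrow> w \<bullet> y \<le> w \<bullet> x"
    by (auto simp: M_def)
  have "opt_support a w \<subseteq> tight a x"
    using complementary_slackness[OF a x(1)] x(2) unfolding opt_support_def plans_on_def by fastforce
  moreover have "(p, q) \<in> opt_support a w" if pq: "(p, q) \<in> tight a x" for p q
  proof -
    \<comment> \<open>The generator \<open>- w\<close> forces \<open>w \<bullet> y \<ge> 0\<close>
      for a separating direction \<open>y\<close>, so moving along \<open>y\<close> keeps
      \<open>x\<close> a maximizer while the constraint of \<open>(p, q)\<close> becomes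
      slack.\<close>
    let ?G = "insert (- w) ((\<lambda>(p, q). root_vec p q) ` tight a x)"
    have GS: "?G \<subseteq> sum_zero_space"
      using w root_vec_sum_zero subspace_neg[OF subspace_sum_zero] by auto
    have "- root_vec p q \<in> convex_cone hull ?G"
    proof (rule ccontr)
      assume nin: "- root_vec p q \<notin> convex_cone hull ?G"
      obtain y where y: "y \<in> sum_zero_space" "\<And>g. g \<in> ?G \<Longrightarrow> g \<bullet> y \<le> 0" "- root_vec p q \<bullet> y > 0"
        by (rule farkas_sum_zero[OF _ GS _ nin])
          (use root_vec_sum_zero subspace_neg[OF subspace_sum_zero] that in auto)
      have "y $ i \<le> y $ j" if "(i, j) \<in> tight a x" for i j
        using y(2)[of "root_vec i j"] that by (force simp: inner_root_vec)
      then obtain e where e: "0 < e" "x + e *\<^sub>R y \<in> alcoved a"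
        "tight a (x + e *\<^sub>R y) \<subseteq> {(i, j) \<in> tight a x. y $ i = y $ j}"
        by (rule move_in_alcoved[OF a x(1) y(1)])
      have "w \<bullet> y \<ge> 0" using y(2)[of "- w"] by simp
      then have "w \<bullet> x \<le> w \<bullet> (x + e *\<^sub>R y)" using e(1) by (simp add: inner_add_right)
      then have "x + e *\<^sub>R y \<in> M" using e(2) x(2) by (force simp: M_def)
      moreover have "tight a (x + e *\<^sub>R y) \<subset> tight a x"
        using e(3) pq y(3) by (auto simp: inner_root_vec)
      then have "card (tight a (x + e *\<^sub>R y)) < card (tight a x)"
        by (intro psubset_card_mono) auto
      ultimately show False using min by fastforce
    qed
    \<comment> \<open>Splits a member of the hull into a flow on tight edges and a multiple of
      \<open>- w\<close>.\<close>
    moreover have "convex_cone hull ?G \<subseteq> {v - t *\<^sub>R w | v t. v \<in> flow_cone (tight a x) \<and> 0 \<le> t}" (is "_ \<subseteq> ?K")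
    proof (rule hull_minimal)
      note C = convex_cone_flow_cone[of "tight a x"]
      have "root_vec i j \<in> ?K" if "(i, j) \<in> tight a x" for i j
        using that unfolding flow_cone_eq_hull
        by (auto intro!: exI[of _ "root_vec i j"] exI[of _ "0::real"] hull_inc)
      moreover have "- w \<in> ?K"
        using convex_cone_contains_0[OF C] by (auto intro!: exI[of _ "0 :: real ^ 'n"] exI[of _ "1::real"])
      ultimately show "?G \<subseteq> ?K" by auto
      show "convex_cone ?K"
        unfolding convex_cone_iff
      proof (intro conjI ballI allI impI)
        show "0 \<in> ?K"
          using convex_cone_contains_0[OF C] by (auto intro!: exI[of _ "0 :: real ^ 'n"] exI[of _ "0::real"])
      next
        fix u v assume "u \<in> ?K" "v \<in> ?K"
        then obtain u' s v' t where "u = u' - s *\<^sub>R w" "v = v' - t *\<^sub>R w" "0 \<le> s" "0 \<le> t"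
          "u' \<in> flow_cone (tight a x)" "v' \<in> flow_cone (tight a x)" by blast
        then have "u + v = (u' + v') - (s + t) *\<^sub>R w" "0 \<le> s + t" "u' + v' \<in> flow_cone (tight a x)"
          using convex_cone_add[OF C] by (auto simp: scaleR_add_left)
        then show "u + v \<in> ?K" by blast
      next
        fix u c assume "u \<in> ?K" "0 \<le> (c::real)"
        then obtain u' s where "u = u' - s *\<^sub>R w" "0 \<le> s" "u' \<in> flow_cone (tight a x)" by blast
        then have "c *\<^sub>R u = c *\<^sub>R u' - (c * s) *\<^sub>R w" "0 \<le> c * s" "c *\<^sub>R u' \<in> flow_cone (tight a x)"
          using convex_cone_scaleR[OF C] \<open>0 \<le> c\<close> by (auto simp: scaleR_diff_right)
        then show "c *\<^sub>R u \<in> ?K" by blast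
      qed
    qed
    ultimately obtain n t where n: "n \<in> plans_on (tight a x)" "0 \<le> t" "- root_vec p q = boundary n - t *\<^sub>R w"
      unfolding flow_cone_def by blast
    obtain l where l: "opt a l" "boundary l = w"
      using opt_exists[OF a w] by blast
    have lt: "l \<in> plans_on (tight a x)"
      using complementary_slackness[OF a x(1) l(1)] x(2) l(2) by simp
    \<comment> \<open>The summand \<open>l\<close> covers the case \<open>t = 0\<close>, where \<open>n + unit_plan p q\<close> is a circulation.\<close>
    define m where "m = inverse (1 + t) *\<^sub>R (l + n + unit_plan p q)"
    have m: "m \<in> plans_on (tight a x)"
      unfolding m_def using lt n pq by (intro plans_on_scaleR plans_on_add plans_on_unit) auto
    have "boundary l + boundary n + root_vec p q = (1 + t) *\<^sub>R w"
      using n(3) l(2) by (simp add: algebra_simps eq_diff_eq neg_eq_iff_add_eq_0)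
    then have "boundary m = w"
      using n(2) by (simp add: m_def boundary_add boundary_scaleR boundary_unit_plan)
    moreover have "0 < (l + n + unit_plan p q) $ p $ q"
      using plans_on_nonneg[OF lt, of p q] plans_on_nonneg[OF n(1), of p q] by (simp add: unit_plan_nth)
    then have "0 < m $ p $ q"
      using n(2) by (simp add: m_def)
    moreover have "opt a m" by (rule opt_on_tight[OF a x(1) m])
    ultimately show ?thesis by (auto simp: opt_support_def)
  qed
  ultimately show ?thesis using x(1) by (intro bexI[of _ x]) auto
qed

text \<open>Tight sets of polytope points are exactly the sets \<open>opt_support a w\<close>, which
  depend on \<open>opt a\<close> only, and they determine the normal cones.\<close>

lemma same_opt_fan:
  assumes a: "a \<in> minimal_params" and b: "b \<in> minimal_params"
    and same: "\<And>l. opt a l \<longleftrightarrow> opt b l"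
  shows "normal_fan (alcoved a) = normal_fan (alcoved b)"
proof -
  have "normal_fan (alcoved a) \<subseteq> normal_fan (alcoved b)"
    if a: "a \<in> minimal_params" and b: "b \<in> minimal_params"
      and same: "\<And>l. opt a l \<longleftrightarrow> opt b l" for a b :: "real ^ 'a ^ 'a"
  proof
    fix N assume "N \<in> normal_fan (alcoved a)"
    then obtain x where x: "x \<in> alcoved a" "N = normal_cone (alcoved a) {x}"
      using normal_fan_eq_point_cones[OF a] by blast
    obtain w where w: "w \<in> sum_zero_space" "opt_support a w = tight a x"
      using tight_eq_opt_support[OF a x(1)] by blast
    obtain y where y: "y \<in> alcoved b" "tight b y = opt_support b w"
      using opt_support_eq_tight[OF b w(1)] by blast
    have "opt_support a w = opt_support b w" by (simp add: opt_support_def same)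
    then have "normal_cone (alcoved a) {x} = normal_cone (alcoved b) {y}"
      using normal_cone_iff[OF a x(1)] normal_cone_iff[OF b y(1)] w(2) y(2) by auto
    then show "N \<in> normal_fan (alcoved b)"
      using x(2) y(1) normal_fan_eq_point_cones[OF b] by blast
  qed
  then show ?thesis using assms by (meson subset_antisym)
qed

section \<open>Cones of the type fan\<close>

lemma minimal_params_iff:
  "a \<in> minimal_params \<longleftrightarrow> a \<in> param_space \<and>
     (\<forall>i j. i \<noteq> j \<longrightarrow> (\<exists>x\<in>alcoved a. x $ i - x $ j = a $ i $ j))"
proof -
  have "(\<exists>x\<in>alcoved a. a $ i $ j = x $ i - x $ j \<and> (\<forall>y\<in>alcoved a. y $ i - y $ j \<le> x $ i - x $ j))
      \<longleftrightarrow> (\<exists>x\<in>alcoved a. x $ i - x $ j = a $ i $ j)" if "i \<noteq> j" for i j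
    using that by (metis (mono_tags, lifting) alcoved_def mem_Collect_eq)
  then show ?thesis
    by (simp add: minimal_params_def defines_minimally_def cong: conj_cong imp_cong)
qed

lemma convex_cone_minimal_params: "convex_cone minimal_params"
  unfolding convex_cone_iff
proof (intro conjI ballI allI impI)
  have "0 \<in> alcoved 0"
    by (simp add: alcoved_def sum_zero_space_def)
  then show "0 \<in> minimal_params"
    unfolding minimal_params_iff by (auto simp: param_space_def intro!: bexI[of _ 0])
next
  fix a b :: "real ^ 'a ^ 'a" assume ab: "a \<in> minimal_params" "b \<in> minimal_params"
  show "a + b \<in> minimal_params"
    unfolding minimal_params_iff
  proof (intro conjI allI impI)
    show "a + b \<in> param_space"
      using ab by (simp add: minimal_params_def param_space_def)
    fix i j :: 'a
    obtain x where x: "x \<in> alcoved a" "x $ i - x $ j = a $ i $ j"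
      by (rule minimal_attained[OF ab(1)])
    obtain y where y: "y \<in> alcoved b" "y $ i - y $ j = b $ i $ j"
      by (rule minimal_attained[OF ab(2)])
    have "x + y \<in> sum_zero_space"
      using alcoved_sum_zero[OF x(1)] alcoved_sum_zero[OF y(1)] by (intro subspace_add subspace_sum_zero)
    moreover have "(x + y) $ k - (x + y) $ m \<le> (a + b) $ k $ m" for k m
      using alcoved_le[OF ab(1) x(1), of k m] alcoved_le[OF ab(2) y(1), of k m] by simp
    ultimately have "x + y \<in> alcoved (a + b)"
      by (simp add: alcoved_def)
    moreover have "(x + y) $ i - (x + y) $ j = (a + b) $ i $ j"
      using x(2) y(2) by simp
    ultimately show "\<exists>x\<in>alcoved (a + b). x $ i - x $ j = (a + b) $ i $ j" by blast
  qed
next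
  fix a :: "real ^ 'a ^ 'a" and c :: real assume a: "a \<in> minimal_params" and c: "0 \<le> c"
  show "c *\<^sub>R a \<in> minimal_params"
    unfolding minimal_params_iff
  proof (intro conjI allI impI)
    show "c *\<^sub>R a \<in> param_space"
      using a by (simp add: minimal_params_def param_space_def)
    fix i j :: 'a
    obtain x where x: "x \<in> alcoved a" "x $ i - x $ j = a $ i $ j"
      by (rule minimal_attained[OF a])
    have "c *\<^sub>R x \<in> sum_zero_space"
      using alcoved_sum_zero[OF x(1)] by (intro subspace_scale subspace_sum_zero)
    moreover have "(c *\<^sub>R x) $ k - (c *\<^sub>R x) $ m \<le> (c *\<^sub>R a) $ k $ m" for k m
      using mult_left_mono[OF alcoved_le[OF a x(1), of k m] c] by (simp add: right_diff_distrib)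
    ultimately have "c *\<^sub>R x \<in> alcoved (c *\<^sub>R a)"
      by (simp add: alcoved_def)
    moreover have "(c *\<^sub>R x) $ i - (c *\<^sub>R x) $ j = (c *\<^sub>R a) $ i $ j"
      using x(2) by (simp flip: right_diff_distrib)
    ultimately show "\<exists>x\<in>alcoved (c *\<^sub>R a). x $ i - x $ j = (c *\<^sub>R a) $ i $ j" by blast
  qed
qed

lemma sum_minimal_params:
  assumes "finite I" "\<And>i. i \<in> I \<Longrightarrow> a i \<in> minimal_params"
  shows "(\<Sum>i\<in>I. a i) \<in> minimal_params"
  using assms by (induction I rule: finite_induct)
    (auto intro: convex_cone_add convex_cone_minimal_params convex_cone_contains_0)

text \<open>A plan optimal for a representative is optimal on its whole open cone. The costs for
  which it is optimal form an intersection of closed half-spaces, so this extends to the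
  closure.\<close>

lemma type_fan_common_plan:
  assumes C: "C \<in> type_fan" and w: "w \<in> sum_zero_space"
  shows "\<exists>l. boundary l = w \<and> (\<forall>b\<in>C. opt b l)"
proof -
  obtain c where c: "c \<in> minimal_params" "C = closure (open_type_cone c)"
    using C by (auto simp: type_fan_def)
  obtain l where l: "opt c l" "boundary l = w"
    using opt_exists[OF c(1) w] by blast
  define D where "D = (\<Inter>m\<in>{m \<in> plans_on UNIV. boundary m = boundary l}. {b. l \<bullet> b \<le> m \<bullet> b})"
  have D: "b \<in> D \<longleftrightarrow> opt b l" for b
    using opt_plan[OF l(1)] by (auto simp: D_def opt_def)
  have "closed D"
    unfolding D_def by (intro closed_INT ballI closed_Collect_le continuous_intros)
  moreover have "open_type_cone c \<subseteq> D"
    using same_fan_opt[OF c(1) _ _ l(1)] by (auto simp: open_type_cone_def D)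
  ultimately have "C \<subseteq> D"
    unfolding c(2) by (intro closure_minimal)
  then show ?thesis using l(2) D by blast
qed

text \<open>Since \<open>m\<close> is optimal for each summand, the least total cost is the sum of
  the least costs; a plan attaining it attains each of them.\<close>

lemma opt_sum_iff:
  assumes fin: "finite I" and m: "\<And>i. i \<in> I \<Longrightarrow> opt (a i) m" "boundary m = boundary l" "m \<in> plans_on UNIV"
  shows "opt (\<Sum>i\<in>I. a i) l \<longleftrightarrow> l \<in> plans_on UNIV \<and> (\<forall>i\<in>I. opt (a i) l)"
proof (intro iffI conjI ballI)
  assume l: "opt (\<Sum>i\<in>I. a i) l"
  show lU: "l \<in> plans_on UNIV" by (rule opt_plan[OF l])
  have le: "m \<bullet> a i \<le> l \<bullet> a i" if "i \<in> I" for i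
    using opt_le[OF m(1)[OF that] lU] m(2) by simp
  have "(\<Sum>i\<in>I. l \<bullet> a i) \<le> (\<Sum>i\<in>I. m \<bullet> a i)"
    using opt_le[OF l m(3,2)] by (simp add: inner_sum_right)
  then have eq: "(\<Sum>i\<in>I. m \<bullet> a i) = (\<Sum>i\<in>I. l \<bullet> a i)"
    using sum_mono[OF le] by (intro antisym)
  fix i assume i: "i \<in> I"
  have "m \<bullet> a i = l \<bullet> a i"
    using eq le i fin by (rule sum_mono_inv)
  then show "opt (a i) l"
    using opt_cong_cost[OF m(1)[OF i] lU] m(2) by simp
next
  assume l: "l \<in> plans_on UNIV \<and> (\<forall>i\<in>I. opt (a i) l)"
  then show "opt (\<Sum>i\<in>I. a i) l"
    unfolding opt_def by (auto simp: inner_sum_right intro!: sum_mono)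
qed

text \<open>A point \<open>b\<close> of the open cone of \<open>a k\<close> is the limit of
  \<open>b + e *\<^sub>R ?s\<close> as \<open>e\<close> tends to 0. The optimal plans there are
  those of \<open>?s\<close>, because being optimal for \<open>b\<close>, as for \<open>a k\<close>,
  is already one of the conditions for \<open>?s\<close>.\<close>

lemma open_type_cone_subset_closure:
  fixes a :: "'i \<Rightarrow> real ^ 'n ^ 'n"
  assumes fin: "finite I" and min: "\<And>i. i \<in> I \<Longrightarrow> a i \<in> minimal_params"
    and common: "\<And>w. w \<in> sum_zero_space \<Longrightarrow> \<exists>l\<in>plans_on UNIV. boundary l = w \<and> (\<forall>i\<in>I. opt (a i) l)"
    and k: "k \<in> I"
  shows "open_type_cone (a k) \<subseteq> closure (open_type_cone (\<Sum>i\<in>I. a i))"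
proof
  let ?s = "\<Sum>i\<in>I. a i"
  have s: "?s \<in> minimal_params"
    using fin min by (rule sum_minimal_params)
  fix b assume "b \<in> open_type_cone (a k)"
  then have b: "b \<in> minimal_params" "normal_fan (alcoved b) = normal_fan (alcoved (a k))"
    by (auto simp: open_type_cone_def)
  have opt_b: "opt b l \<longleftrightarrow> opt (a k) l" for l
    using same_fan_opt[OF b(1) min[OF k] b(2)] same_fan_opt[OF min[OF k] b(1) b(2)[symmetric]] by blast
  have "b + e *\<^sub>R ?s \<in> open_type_cone ?s" if e: "0 < e" for e
  proof -
    have be: "b + e *\<^sub>R ?s \<in> minimal_params"
      using e by (intro convex_cone_add convex_cone_minimal_params convex_cone_scaleR b s) simp
    have "opt (b + e *\<^sub>R ?s) l \<longleftrightarrow> opt ?s l" for l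
    proof -
      obtain m where m: "m \<in> plans_on UNIV" "boundary m = boundary l" "\<And>i. i \<in> I \<Longrightarrow> opt (a i) m"
        using common[OF boundary_sum_zero] by blast
      have opt_s: "opt ?s l \<longleftrightarrow> l \<in> plans_on UNIV \<and> (\<forall>i\<in>I. opt (a i) l)"
        using m by (intro opt_sum_iff[OF fin])
      have scale: "opt (e *\<^sub>R ?s) n \<longleftrightarrow> opt ?s n" for n
        using e by (simp add: opt_def)
      have ms: "opt ?s m"
        using m by (subst opt_sum_iff[OF fin, of _ m]) auto
      \<comment> \<open>Writes the two-term sum as a sum over the booleans, so that
        \<open>opt_sum_iff\<close> applies.\<close>
      let ?c = "\<lambda>x. if x then b else e *\<^sub>R ?s"
      have "opt (\<Sum>x\<in>UNIV. ?c x) l \<longleftrightarrow> l \<in> plans_on UNIV \<and> (\<forall>x\<in>UNIV. opt (?c x) l)"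
        using m opt_b k ms scale by (intro opt_sum_iff[of _ _ m]) auto
      then show ?thesis
        using opt_s opt_b[of l] scale[of l] k by (auto simp: UNIV_bool opt_def add.commute)
    qed
    then have "normal_fan (alcoved (b + e *\<^sub>R ?s)) = normal_fan (alcoved ?s)"
      by (rule same_opt_fan[OF be s])
    then show ?thesis
      using be by (simp add: open_type_cone_def)
  qed
  then have "\<forall>n. b + inverse (real (Suc n)) *\<^sub>R ?s \<in> open_type_cone ?s" by simp
  moreover have "(\<lambda>n. b + inverse (real (Suc n)) *\<^sub>R ?s) \<longlonglongrightarrow> b + 0 *\<^sub>R ?s"
    by (intro tendsto_intros LIMSEQ_inverse_real_of_nat)
  ultimately show "b \<in> closure (open_type_cone ?s)"
    unfolding closure_sequential scaleR_zero_left add_0_right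
    by (intro exI[of _ "\<lambda>n. b + inverse (real (Suc n)) *\<^sub>R ?s"] conjI)
qed

theorem theorem2p10:
  fixes \<rho> :: "nat \<Rightarrow> (real ^ 'n ^ 'n) set" and s :: nat
  assumes "\<And>i. i \<in> {1..s} \<Longrightarrow> \<rho> i \<in> fan_rays type_fan"
    and "\<And>i j. i \<in> {1..s} \<Longrightarrow> j \<in> {1..s} \<Longrightarrow>
           \<exists>C\<in>type_fan. \<rho> i \<subseteq> C \<and> \<rho> j \<subseteq> C"
  shows "\<exists>C\<in>type_fan. \<forall>i\<in>{1..s}. \<rho> i \<subseteq> C"
proof -
  let ?I = "{1..s}"
  have "\<exists>a. a \<in> minimal_params \<and> \<rho> i = closure (open_type_cone a)" if "i \<in> ?I" for i
    using assms(1)[OF that] by (auto simp: fan_rays_def type_fan_def)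
  then obtain a where min: "\<And>i. i \<in> ?I \<Longrightarrow> a i \<in> minimal_params"
    and \<rho>: "\<And>i. i \<in> ?I \<Longrightarrow> \<rho> i = closure (open_type_cone (a i))"
    by metis
  have mem: "a i \<in> \<rho> i" if "i \<in> ?I" for i
    unfolding \<rho>[OF that] using min[OF that] closure_subset by (fastforce simp: open_type_cone_def)
  have common: "\<exists>l\<in>plans_on UNIV. boundary l = w \<and> (\<forall>i\<in>?I. opt (a i) l)" if w: "w \<in> sum_zero_space" for w
  proof -
    have "\<exists>l\<in>plans_on UNIV. boundary l = w \<and> (\<forall>b\<in>a ` ?I. opt b l)"
    proof (rule pairwise_common_opt_plan[OF _ _ _ w])
      fix b c and v :: "real ^ 'n"
      assume "b \<in> a ` ?I" "c \<in> a ` ?I" and v: "v \<in> sum_zero_space"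
      then obtain i j where ij: "i \<in> ?I" "b = a i" "j \<in> ?I" "c = a j" by blast
      \<comment> \<open>A cone containing both rays contains \<open>a i\<close> and
        \<open>a j\<close>, hence provides one plan for both.\<close>
      obtain C where C: "C \<in> type_fan" "\<rho> i \<subseteq> C" "\<rho> j \<subseteq> C"
        using assms(2)[OF ij(1,3)] by blast
      then show "\<exists>l. opt b l \<and> opt c l \<and> boundary l = v"
        using type_fan_common_plan[OF C(1) v] mem ij by blast
    next
      show "opt b (unit_plan p q)" if "b \<in> a ` ?I" for b p q
        using that min opt_unit_plan by blast
    qed simp
    then show ?thesis by simp
  qed
  \<comment> \<open>Represents the required cone; for \<open>s = 0\<close> it is the zero
    parameter.\<close>
  define S where "S = (\<Sum>i\<in>?I. a i)"
  have "S \<in> minimal_params"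
    unfolding S_def using min by (intro sum_minimal_params) auto
  then have "closure (open_type_cone S) \<in> type_fan"
    by (auto simp: type_fan_def)
  moreover have "\<rho> i \<subseteq> closure (open_type_cone S)" if "i \<in> ?I" for i
    unfolding \<rho>[OF that] S_def
    by (intro closure_minimal closed_closure open_type_cone_subset_closure[OF _ min common that]) auto
  ultimately show ?thesis by blast
qed

end
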